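(* Let $(M,L,\psi)$ be a weighted Finsler spacetime of dimension $n+1$, let $\mathsf{J}$ be a Jacobi tensor field along a timelike geodesic $\eta:I\to M$ of unit speed, and let $\epsilon\in\mathbb{R}$. Then the weighted Jacobi endomorphism $\mathsf{J}_\psi=e^{-\psi_\eta/n}\mathsf{J}$ satisfies on $I$ $$\mathsf{J}_\psi^{**}+\frac{2\epsilon}{n}\psi_\eta^*\,\mathsf{J}_\psi^*+\mathsf{R}_{(0,\epsilon)}\mathsf{J}_\psi=0.$$
   Context: **Lorentz–Finsler setting.** $M$ is a connected $C^\infty$-manifold without boundary of dimension $n+1\ge2$. A Lorentz–Finsler structure is a function $L:TM\to\mathbb{R}$ such that $L\in C^\infty(TM\setminus\{0\})$; $L(cv)=c^2L(v)$ for all $v\in TM$, $c>0$; and for every $v\in TM\setminus\{0\}$ the matrix $g_{\alpha\beta}(v)=\frac{\partial^2 L}{\partial v^\alpha\partial v^\beta}(v)$, $\alpha,\beta=0,\dots,n$, is non-degenerate of signature $(-,+,\dots,+)$. It defines a Lorentzian inner product $g_v$ on $T_xM$ (for $v\in T_xM\setminus\{0\}$), with $g_v(v,v)=2L(v)$. A vector $v$ is timelike if $L(v)<0$, lightlike if $L(v)=0$ and $v\ne 0$, causal if timelike or lightlike. A Finsler spacetime is such an $(M,L)$ time-oriented by a smooth vector field $X$ with $L(X(x))<0$ for all $x$. A causal $v\in T_xM$ is future-directed if it lies in the same connected component of $\overline{\Omega'_x}\setminus\{0\}$ as $X(x)$, where $\Omega'_x=\{v\in T_xM: L(v)<0\}$.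 $\Omega_x$ is the set of future-directed timelike vectors, $\overline\Omega=\bigcup_x\overline\Omega_x$. $F(v)=\sqrt{-2L(v)}$ on causal vectors; a timelike geodesic has unit speed if $F(\dot\eta)\equiv1$. All causal curves and geodesics are future-directed. **Connection and curvature.** With $(g^{\alpha\beta}(v))$ the inverse matrix, set $\widetilde\Gamma^\alpha_{\beta\gamma}(v)=\frac12\sum_\delta g^{\alpha\delta}(v)\big(\frac{\partial g_{\delta\gamma}}{\partial x^\beta}+\frac{\partial g_{\beta\delta}}{\partial x^\gamma}-\frac{\partial g_{\beta\gamma}}{\partial x^\delta}\big)(v)$, $G^\alpha(v)=\frac12\sum_{\beta,\gamma}\widetilde\Gamma^\alpha_{\beta\gamma}(v)v^\beta v^\gamma$, $N^\alpha_\beta(v)=\frac{\partial G^\alpha}{\partial v^\beta}(v)$, and $\Gamma^\alpha_{\beta\gamma}(v)=\widetilde\Gamma^\alpha_{\beta\gamma}(v)-\frac12\sum_{\delta,\mu}g^{\alpha\delta}(v)\big(\frac{\partial g_{\delta\gamma}}{\partial v^\mu}N^\mu_\beta+\frac{\partial g_{\beta\delta}}{\partial v^\mu}N^\mu_\gamma-\frac{\partial g_{\beta\gamma}}{\partial v^\mu}N^\mu_\delta\big)(v)$. Along a curve $\eta$, the covariant derivative $Y'=D^{\dot\eta}_{\dot\eta}Y$ has components $\dot Y^\alpha+\sum\Gamma^\alpha_{\beta\gamma}(\dot\eta)\dot\eta^\beta Y^\gamma$; for endomorphism fields $E$, $E'(P)=E(P)'-E(P')$. A causal geodesic is a smooth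 causal curve with $\ddot\eta^\alpha+2G^\alpha(\dot\eta)=0$. Put $R^\alpha_\beta(v)=2\frac{\partial G^\alpha}{\partial x^\beta}-\sum_\gamma\big(\frac{\partial N^\alpha_\beta}{\partial x^\gamma}v^\gamma-2\frac{\partial N^\alpha_\beta}{\partial v^\gamma}G^\gamma\big)-\sum_\gamma N^\alpha_\gamma N^\gamma_\beta$ (all at $v$), and $R_v(w)=\sum R^\alpha_\beta(v)w^\beta\frac{\partial}{\partial x^\alpha}$. **Weight.** $\psi:\overline\Omega\setminus\{0\}\to\mathbb{R}$ is $C^\infty$ with $\psi(cv)=\psi(v)$ for $c>0$; $\psi_\eta(t)=\psi(\dot\eta(t))$. **Jacobi tensors, $\epsilon$-proper time.** Let $\eta:I\to M$ be a unit-speed timelike geodesic, $N_\eta(t)\subset T_{\eta(t)}M$ the $n$-dimensional $g_{\dot\eta(t)}$-orthogonal complement of $\dot\eta(t)$, $\mathsf{R}(t)=R_{\dot\eta(t)}:N_\eta(t)\to N_\eta(t)$, and $I_n$ the identity of $N_\eta(t)$. A Jacobi tensor field is a smooth field of endomorphisms $\mathsf{J}(t)$ of $N_\eta(t)$ with $\mathsf{J}''+\mathsf{R}\mathsf{J}=0$ and $\ker\mathsf{J}(t)\cap\ker\mathsf{J}'(t)=\{0\}$ for all $t\in I$. The $\epsilon$-proper time is $\tau_\epsilon=\int e^{\frac{2(\epsilon-1)}{n}\psi_\eta(t)}dt$, and $*$ denotes the (covariant) derivative with respect to $\tau_\epsilon$, i.e. $(\cdot)^*=e^{\frac{2(1-\epsilon)}{n}\psi_\eta}(\cdot)'$.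 The weighted curvature endomorphism is, for $N\ne n$, $\mathsf{R}_{(N,\epsilon)}(t)=e^{\frac{4(1-\epsilon)}{n}\psi_\eta(t)}\big\{\mathsf{R}(t)+\frac1n\big(\psi_\eta''(t)-\frac{\psi_\eta'(t)^2}{N-n}\big)I_n\big\}$; here it is used with $N=0$. *)

theory Defs
  imports "HOL-Analysis.Analysis"
begin

section \<open>Smooth functions and smooth manifolds\<close>

primrec Ck_on :: "nat \<Rightarrow> 'a::euclidean_space set \<Rightarrow> ('a \<Rightarrow> 'b::real_normed_vector) \<Rightarrow> bool" where
  "Ck_on 0 U f \<longleftrightarrow> continuous_on U f"
| "Ck_on (Suc k) U f \<longleftrightarrow> (\<forall>x\<in>U. f differentiable (at x)) \<and>
     (\<forall>h. Ck_on k U (\<lambda>x. frechet_derivative f (at x) h))"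

text \<open>On a set that need not be open (an interval with end points, the closed cones of causal
  vectors), smoothness means existence of local smooth extensions to open sets.\<close>

definition smooth_on :: "'a::euclidean_space set \<Rightarrow> ('a \<Rightarrow> 'b::real_normed_vector) \<Rightarrow> bool" where
  "smooth_on S f \<longleftrightarrow>
     (\<forall>x\<in>S. \<exists>U g. open U \<and> x \<in> U \<and> (\<forall>k. Ck_on k U g) \<and> (\<forall>y\<in>U \<inter> S. g y = f y))"

type_synonym ('m, 'd) chart = "'m set \<times> ('m \<Rightarrow> real ^ 'd)"

abbreviation cdom :: "('m, 'd) chart \<Rightarrow> 'm set" where "cdom c \<equiv> fst c"

abbreviation cmap :: "('m, 'd) chart \<Rightarrow> 'm \<Rightarrow> real ^ 'd" where "cmap c \<equiv> snd c"

definition cimage :: "('m, 'd) chart \<Rightarrow> (real ^ 'd) set" where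
  "cimage c = cmap c ` cdom c"

definition cinv :: "('m, 'd) chart \<Rightarrow> real ^ 'd \<Rightarrow> 'm" where
  "cinv c = inv_into (cdom c) (cmap c)"

definition smooth_manifold :: "'m topology \<Rightarrow> ('m, 'd::finite) chart set \<Rightarrow> bool" where
  "smooth_manifold T A \<longleftrightarrow>
     Hausdorff_space T \<and> second_countable T \<and>
     (\<forall>c\<in>A. openin T (cdom c) \<and> open (cimage c) \<and>
        homeomorphic_map (subtopology T (cdom c)) (top_of_set (cimage c)) (cmap c)) \<and>
     (\<Union>c\<in>A. cdom c) = topspace T \<and>
     (\<forall>c\<in>A. \<forall>c'\<in>A. smooth_on (cmap c ` (cdom c \<inter> cdom c')) (cmap c' \<circ> cinv c))"


section \<open>The tangent bundle\<close>

text \<open>A tangent vector at a point consists of its components in all charts of the atlas around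
  that point, related by the Jacobians of the coordinate changes; the entries at all other
  charts are set to 0 to make the representation unique.\<close>

type_synonym ('m, 'd) tvec = "'m \<times> (('m, 'd) chart \<Rightarrow> real ^ 'd)"

abbreviation tbase :: "('m, 'd) tvec \<Rightarrow> 'm" where "tbase v \<equiv> fst v"

abbreviation tcomp :: "('m, 'd) tvec \<Rightarrow> ('m, 'd) chart \<Rightarrow> real ^ 'd" where "tcomp v \<equiv> snd v"

definition charts_at :: "('m, 'd) chart set \<Rightarrow> 'm \<Rightarrow> ('m, 'd) chart set" where
  "charts_at A p = {c \<in> A. p \<in> cdom c}"

definition tangent_space :: "('m, 'd::finite) chart set \<Rightarrow> 'm \<Rightarrow> ('m, 'd) tvec set" where
  "tangent_space A p = {v. tbase v = p \<and>
     (\<forall>c\<in>charts_at A p. \<forall>c'\<in>charts_at A p.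
        tcomp v c' = frechet_derivative (cmap c' \<circ> cinv c) (at (cmap c p)) (tcomp v c)) \<and>
     (\<forall>c. c \<notin> charts_at A p \<longrightarrow> tcomp v c = 0)}"

definition tzero :: "'m \<Rightarrow> ('m, 'd::finite) tvec" where
  "tzero p = (p, \<lambda>c. 0)"

definition tadd :: "('m, 'd::finite) tvec \<Rightarrow> ('m, 'd) tvec \<Rightarrow> ('m, 'd) tvec" where
  "tadd v w = (tbase v, \<lambda>c. tcomp v c + tcomp w c)"

definition tscale :: "real \<Rightarrow> ('m, 'd::finite) tvec \<Rightarrow> ('m, 'd) tvec" where
  "tscale a v = (tbase v, \<lambda>c. a *\<^sub>R tcomp v c)"

definition tangent_bundle :: "'m topology \<Rightarrow> ('m, 'd::finite) chart set \<Rightarrow> ('m, 'd) tvec set" where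
  "tangent_bundle T A = (\<Union>p\<in>topspace T. tangent_space A p)"

definition zero_section :: "'m topology \<Rightarrow> ('m, 'd::finite) tvec set" where
  "zero_section T = tzero ` topspace T"

text \<open>The tangent vector with components \<open>v\<close> in the chart \<open>c\<close> at the point with coordinates \<open>x\<close>.\<close>

definition tvec_of ::
  "('m, 'd::finite) chart set \<Rightarrow> ('m, 'd) chart \<Rightarrow> (real ^ 'd) \<times> (real ^ 'd) \<Rightarrow> ('m, 'd) tvec" where
  "tvec_of A c = (\<lambda>(x, v). (cinv c x, \<lambda>c'. if c' \<in> charts_at A (cinv c x)
     then frechet_derivative (cmap c' \<circ> cinv c) (at x) v else 0))"

definition tcoords :: "('m, 'd) chart \<Rightarrow> ('m, 'd) tvec \<Rightarrow> (real ^ 'd) \<times> (real ^ 'd)" where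
  "tcoords c v = (cmap c (tbase v), tcomp v c)"

definition local_rep ::
  "('m, 'd::finite) chart set \<Rightarrow> (('m, 'd) tvec \<Rightarrow> real) \<Rightarrow> ('m, 'd) chart
    \<Rightarrow> (real ^ 'd) \<times> (real ^ 'd) \<Rightarrow> real" where
  "local_rep A f c = (\<lambda>z. f (tvec_of A c z))"

definition smooth_on_bundle ::
  "('m, 'd::finite) chart set \<Rightarrow> ('m, 'd) tvec set \<Rightarrow> (('m, 'd) tvec \<Rightarrow> real) \<Rightarrow> bool" where
  "smooth_on_bundle A W f \<longleftrightarrow>
     (\<forall>c\<in>A. smooth_on {z. fst z \<in> cimage c \<and> tvec_of A c z \<in> W} (local_rep A f c))"

definition smooth_vector_field ::
  "'m topology \<Rightarrow> ('m, 'd::finite) chart set \<Rightarrow> ('m \<Rightarrow> ('m, 'd) tvec) \<Rightarrow> bool" where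
  "smooth_vector_field T A X \<longleftrightarrow> (\<forall>p\<in>topspace T. X p \<in> tangent_space A p) \<and>
     (\<forall>c\<in>A. smooth_on (cimage c) (\<lambda>x. tcomp (X (cinv c x)) c))"


section \<open>Coordinate expressions of a Lagrangian\<close>

text \<open>Here \<open>F\<close> is a function of the induced coordinates \<open>(x, v)\<close> on the tangent bundle, and
  \<open>pdx\<close>, \<open>pdv\<close> are the partial derivatives in the two groups of variables.\<close>

definition pdx :: "'d::finite \<Rightarrow> ((real ^ 'd) \<times> (real ^ 'd) \<Rightarrow> real)
    \<Rightarrow> (real ^ 'd) \<times> (real ^ 'd) \<Rightarrow> real" where
  "pdx \<alpha> F = (\<lambda>(x, v). deriv (\<lambda>s. F (x + s *\<^sub>R axis \<alpha> 1, v)) 0)"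

definition pdv :: "'d::finite \<Rightarrow> ((real ^ 'd) \<times> (real ^ 'd) \<Rightarrow> real)
    \<Rightarrow> (real ^ 'd) \<times> (real ^ 'd) \<Rightarrow> real" where
  "pdv \<alpha> F = (\<lambda>(x, v). deriv (\<lambda>s. F (x, v + s *\<^sub>R axis \<alpha> 1)) 0)"

definition gco :: "((real ^ 'd::finite) \<times> (real ^ 'd) \<Rightarrow> real) \<Rightarrow> 'd \<Rightarrow> 'd
    \<Rightarrow> (real ^ 'd) \<times> (real ^ 'd) \<Rightarrow> real" where
  "gco F \<alpha> \<beta> = pdv \<alpha> (pdv \<beta> F)"

definition gmat :: "((real ^ 'd::finite) \<times> (real ^ 'd) \<Rightarrow> real)
    \<Rightarrow> (real ^ 'd) \<times> (real ^ 'd) \<Rightarrow> real ^ 'd ^ 'd" where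
  "gmat F z = (\<chi> \<alpha> \<beta>. gco F \<alpha> \<beta> z)"

definition ginv :: "((real ^ 'd::finite) \<times> (real ^ 'd) \<Rightarrow> real) \<Rightarrow> 'd \<Rightarrow> 'd
    \<Rightarrow> (real ^ 'd) \<times> (real ^ 'd) \<Rightarrow> real" where
  "ginv F \<alpha> \<beta> z = matrix_inv (gmat F z) $ \<alpha> $ \<beta>"

definition Gamma_tilde :: "((real ^ 'd::finite) \<times> (real ^ 'd) \<Rightarrow> real) \<Rightarrow> 'd \<Rightarrow> 'd \<Rightarrow> 'd
    \<Rightarrow> (real ^ 'd) \<times> (real ^ 'd) \<Rightarrow> real" where
  "Gamma_tilde F \<alpha> \<beta> \<gamma> z = 1/2 * (\<Sum>\<delta>\<in>UNIV. ginv F \<alpha> \<delta> z *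
     (pdx \<beta> (gco F \<delta> \<gamma>) z + pdx \<gamma> (gco F \<beta> \<delta>) z - pdx \<delta> (gco F \<beta> \<gamma>) z))"

definition spray :: "((real ^ 'd::finite) \<times> (real ^ 'd) \<Rightarrow> real) \<Rightarrow> 'd
    \<Rightarrow> (real ^ 'd) \<times> (real ^ 'd) \<Rightarrow> real" where
  "spray F \<alpha> z = 1/2 * (\<Sum>\<beta>\<in>UNIV. \<Sum>\<gamma>\<in>UNIV. Gamma_tilde F \<alpha> \<beta> \<gamma> z * snd z $ \<beta> * snd z $ \<gamma>)"

definition nonlin_conn :: "((real ^ 'd::finite) \<times> (real ^ 'd) \<Rightarrow> real) \<Rightarrow> 'd \<Rightarrow> 'd
    \<Rightarrow> (real ^ 'd) \<times> (real ^ 'd) \<Rightarrow> real" where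
  "nonlin_conn F \<alpha> \<beta> = pdv \<beta> (spray F \<alpha>)"

definition Gamma :: "((real ^ 'd::finite) \<times> (real ^ 'd) \<Rightarrow> real) \<Rightarrow> 'd \<Rightarrow> 'd \<Rightarrow> 'd
    \<Rightarrow> (real ^ 'd) \<times> (real ^ 'd) \<Rightarrow> real" where
  "Gamma F \<alpha> \<beta> \<gamma> z = Gamma_tilde F \<alpha> \<beta> \<gamma> z -
     1/2 * (\<Sum>\<delta>\<in>UNIV. \<Sum>\<mu>\<in>UNIV. ginv F \<alpha> \<delta> z *
       (pdv \<mu> (gco F \<delta> \<gamma>) z * nonlin_conn F \<mu> \<beta> z
        + pdv \<mu> (gco F \<beta> \<delta>) z * nonlin_conn F \<mu> \<gamma> z
        - pdv \<mu> (gco F \<beta> \<gamma>) z * nonlin_conn F \<mu> \<delta> z))"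

definition Rco :: "((real ^ 'd::finite) \<times> (real ^ 'd) \<Rightarrow> real) \<Rightarrow> 'd \<Rightarrow> 'd
    \<Rightarrow> (real ^ 'd) \<times> (real ^ 'd) \<Rightarrow> real" where
  "Rco F \<alpha> \<beta> z = 2 * pdx \<beta> (spray F \<alpha>) z
     - (\<Sum>\<gamma>\<in>UNIV. pdx \<gamma> (nonlin_conn F \<alpha> \<beta>) z * snd z $ \<gamma>
                  - 2 * pdv \<gamma> (nonlin_conn F \<alpha> \<beta>) z * spray F \<gamma> z)
     - (\<Sum>\<gamma>\<in>UNIV. nonlin_conn F \<alpha> \<gamma> z * nonlin_conn F \<gamma> \<beta> z)"

text \<open>Signature \<open>(-,+,\<dots>,+)\<close>: in a suitable basis the matrix becomes \<open>diag(-1,1,\<dots>,1)\<close>.\<close>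

definition lorentz_signature :: "real ^ 'd ^ 'd::finite \<Rightarrow> bool" where
  "lorentz_signature M \<longleftrightarrow> (\<exists>(P :: real ^ 'd ^ 'd) \<alpha>\<^sub>0. invertible P \<and>
     transpose P ** M ** P = (\<chi> \<alpha> \<beta>. if \<alpha> \<noteq> \<beta> then 0 else if \<alpha> = \<alpha>\<^sub>0 then -1 else 1))"


section \<open>Weighted Finsler spacetimes\<close>

definition lorentz_finsler ::
  "'m topology \<Rightarrow> ('m, 'd::finite) chart set \<Rightarrow> (('m, 'd) tvec \<Rightarrow> real) \<Rightarrow> bool" where
  "lorentz_finsler T A L \<longleftrightarrow>
     smooth_on_bundle A (tangent_bundle T A - zero_section T) L \<and>
     (\<forall>v\<in>tangent_bundle T A. \<forall>a>0. L (tscale a v) = a\<^sup>2 * L v) \<and>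
     (\<forall>v\<in>tangent_bundle T A - zero_section T. \<forall>c\<in>charts_at A (tbase v).
        invertible (gmat (local_rep A L c) (tcoords c v)) \<and>
        lorentz_signature (gmat (local_rep A L c) (tcoords c v)))"

definition timelike :: "(('m, 'd) tvec \<Rightarrow> real) \<Rightarrow> ('m, 'd) tvec \<Rightarrow> bool" where
  "timelike L v \<longleftrightarrow> L v < 0"

definition lightlike :: "(('m, 'd::finite) tvec \<Rightarrow> real) \<Rightarrow> ('m, 'd) tvec \<Rightarrow> bool" where
  "lightlike L v \<longleftrightarrow> L v = 0 \<and> v \<noteq> tzero (tbase v)"

definition causal :: "(('m, 'd::finite) tvec \<Rightarrow> real) \<Rightarrow> ('m, 'd) tvec \<Rightarrow> bool" where
  "causal L v \<longleftrightarrow> timelike L v \<or> lightlike L v"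

text \<open>Closures and connected components in a tangent space are taken with respect to its
  topology as a finite-dimensional vector space, i.e. after passing to components in a chart.\<close>

definition future_directed ::
  "('m, 'd::finite) chart set \<Rightarrow> (('m, 'd) tvec \<Rightarrow> real) \<Rightarrow> ('m \<Rightarrow> ('m, 'd) tvec)
    \<Rightarrow> ('m, 'd) tvec \<Rightarrow> bool" where
  "future_directed A L X v \<longleftrightarrow> causal L v \<and>
     (\<forall>c\<in>charts_at A (tbase v).
        connected_component
          (closure ((\<lambda>w. tcomp w c) ` {w \<in> tangent_space A (tbase v). timelike L w}) - {0})
          (tcomp (X (tbase v)) c) (tcomp v c))"

definition Omega ::
  "('m, 'd::finite) chart set \<Rightarrow> (('m, 'd) tvec \<Rightarrow> real) \<Rightarrow> ('m \<Rightarrow> ('m, 'd) tvec)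
    \<Rightarrow> 'm \<Rightarrow> ('m, 'd) tvec set" where
  "Omega A L X p = {v \<in> tangent_space A p. timelike L v \<and> future_directed A L X v}"

definition Omega_bar ::
  "'m topology \<Rightarrow> ('m, 'd::finite) chart set \<Rightarrow> (('m, 'd) tvec \<Rightarrow> real)
    \<Rightarrow> ('m \<Rightarrow> ('m, 'd) tvec) \<Rightarrow> ('m, 'd) tvec set" where
  "Omega_bar T A L X = {v \<in> tangent_bundle T A. \<forall>c\<in>charts_at A (tbase v).
     tcomp v c \<in> closure ((\<lambda>w. tcomp w c) ` Omega A L X (tbase v))}"

definition finsler_spacetime ::
  "'m topology \<Rightarrow> ('m, 'd::finite) chart set \<Rightarrow> (('m, 'd) tvec \<Rightarrow> real)
    \<Rightarrow> ('m \<Rightarrow> ('m, 'd) tvec) \<Rightarrow> bool" where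
  "finsler_spacetime T A L X \<longleftrightarrow>
     smooth_manifold T A \<and> connected_space T \<and> lorentz_finsler T A L \<and>
     smooth_vector_field T A X \<and> (\<forall>p\<in>topspace T. timelike L (X p))"

definition weighted_finsler_spacetime ::
  "'m topology \<Rightarrow> ('m, 'd::finite) chart set \<Rightarrow> (('m, 'd) tvec \<Rightarrow> real)
    \<Rightarrow> ('m \<Rightarrow> ('m, 'd) tvec) \<Rightarrow> (('m, 'd) tvec \<Rightarrow> real) \<Rightarrow> bool" where
  "weighted_finsler_spacetime T A L X \<psi> \<longleftrightarrow> finsler_spacetime T A L X \<and>
     smooth_on_bundle A (Omega_bar T A L X - zero_section T) \<psi> \<and>
     (\<forall>v\<in>Omega_bar T A L X - zero_section T. \<forall>a>0. \<psi> (tscale a v) = \<psi> v)"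


section \<open>Curves, covariant derivative, geodesics\<close>

abbreviation deriv_on :: "real set \<Rightarrow> (real \<Rightarrow> 'a::real_normed_vector) \<Rightarrow> real \<Rightarrow> 'a" where
  "deriv_on I f t \<equiv> vector_derivative f (at t within I)"

definition smooth_curve ::
  "'m topology \<Rightarrow> ('m, 'd::finite) chart set \<Rightarrow> real set \<Rightarrow> (real \<Rightarrow> 'm) \<Rightarrow> bool" where
  "smooth_curve T A I \<eta> \<longleftrightarrow> continuous_map (top_of_set I) T \<eta> \<and>
     (\<forall>c\<in>A. smooth_on {t \<in> I. \<eta> t \<in> cdom c} (\<lambda>t. cmap c (\<eta> t)))"

definition velocity ::
  "('m, 'd::finite) chart set \<Rightarrow> real set \<Rightarrow> (real \<Rightarrow> 'm) \<Rightarrow> real \<Rightarrow> ('m, 'd) tvec" where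
  "velocity A I \<eta> t = (\<eta> t, \<lambda>c. if c \<in> charts_at A (\<eta> t)
     then deriv_on I (\<lambda>s. cmap c (\<eta> s)) t else 0)"

definition smooth_field_along ::
  "('m, 'd::finite) chart set \<Rightarrow> real set \<Rightarrow> (real \<Rightarrow> 'm) \<Rightarrow> (real \<Rightarrow> ('m, 'd) tvec) \<Rightarrow> bool" where
  "smooth_field_along A I \<eta> Y \<longleftrightarrow> (\<forall>t\<in>I. Y t \<in> tangent_space A (\<eta> t)) \<and>
     (\<forall>c\<in>A. smooth_on {t \<in> I. \<eta> t \<in> cdom c} (\<lambda>t. tcomp (Y t) c))"

text \<open>Covariant derivative along \<open>\<eta>\<close> with reference vector the velocity of \<open>\<eta>\<close>, given by
  its components in all charts at once.\<close>

definition cov_deriv ::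
  "('m, 'd::finite) chart set \<Rightarrow> (('m, 'd) tvec \<Rightarrow> real) \<Rightarrow> real set \<Rightarrow> (real \<Rightarrow> 'm)
    \<Rightarrow> (real \<Rightarrow> ('m, 'd) tvec) \<Rightarrow> real \<Rightarrow> ('m, 'd) tvec" where
  "cov_deriv A L I \<eta> Y t = (\<eta> t, \<lambda>c. if c \<in> charts_at A (\<eta> t)
     then deriv_on I (\<lambda>s. tcomp (Y s) c) t +
       (\<chi> \<alpha>. \<Sum>\<beta>\<in>UNIV. \<Sum>\<gamma>\<in>UNIV.
          Gamma (local_rep A L c) \<alpha> \<beta> \<gamma> (tcoords c (velocity A I \<eta> t))
            * tcomp (velocity A I \<eta> t) c $ \<beta> * tcomp (Y t) c $ \<gamma>)
     else 0)"

definition causal_geodesic ::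
  "'m topology \<Rightarrow> ('m, 'd::finite) chart set \<Rightarrow> (('m, 'd) tvec \<Rightarrow> real)
    \<Rightarrow> ('m \<Rightarrow> ('m, 'd) tvec) \<Rightarrow> real set \<Rightarrow> (real \<Rightarrow> 'm) \<Rightarrow> bool" where
  "causal_geodesic T A L X I \<eta> \<longleftrightarrow> smooth_curve T A I \<eta> \<and>
     (\<forall>t\<in>I. causal L (velocity A I \<eta> t) \<and> future_directed A L X (velocity A I \<eta> t)) \<and>
     (\<forall>t\<in>I. \<forall>c\<in>charts_at A (\<eta> t). \<forall>\<alpha>.
        deriv_on I (\<lambda>s. tcomp (velocity A I \<eta> s) c) t $ \<alpha>
          + 2 * spray (local_rep A L c) \<alpha> (tcoords c (velocity A I \<eta> t)) = 0)"

definition Fnorm :: "(('m, 'd) tvec \<Rightarrow> real) \<Rightarrow> ('m, 'd) tvec \<Rightarrow> real" where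
  "Fnorm L v = sqrt (- 2 * L v)"

definition unit_speed_timelike_geodesic ::
  "'m topology \<Rightarrow> ('m, 'd::finite) chart set \<Rightarrow> (('m, 'd) tvec \<Rightarrow> real)
    \<Rightarrow> ('m \<Rightarrow> ('m, 'd) tvec) \<Rightarrow> real set \<Rightarrow> (real \<Rightarrow> 'm) \<Rightarrow> bool" where
  "unit_speed_timelike_geodesic T A L X I \<eta> \<longleftrightarrow> causal_geodesic T A L X I \<eta> \<and>
     (\<forall>t\<in>I. timelike L (velocity A I \<eta> t) \<and> Fnorm L (velocity A I \<eta> t) = 1)"


section \<open>Endomorphism fields and Jacobi tensor fields\<close>

text \<open>The orthogonal complement of the velocity with respect to the inner product it defines.
  That product does not depend on the chart, so the quantifier over charts is harmless.\<close>

definition orth_space ::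
  "('m, 'd::finite) chart set \<Rightarrow> (('m, 'd) tvec \<Rightarrow> real) \<Rightarrow> real set \<Rightarrow> (real \<Rightarrow> 'm)
    \<Rightarrow> real \<Rightarrow> ('m, 'd) tvec set" where
  "orth_space A L I \<eta> t = {w \<in> tangent_space A (\<eta> t). \<forall>c\<in>charts_at A (\<eta> t).
     (\<Sum>\<alpha>\<in>UNIV. \<Sum>\<beta>\<in>UNIV. gco (local_rep A L c) \<alpha> \<beta> (tcoords c (velocity A I \<eta> t))
        * tcomp (velocity A I \<eta> t) c $ \<alpha> * tcomp w c $ \<beta>) = 0}"

definition smooth_normal_field ::
  "('m, 'd::finite) chart set \<Rightarrow> (('m, 'd) tvec \<Rightarrow> real) \<Rightarrow> real set \<Rightarrow> (real \<Rightarrow> 'm)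
    \<Rightarrow> (real \<Rightarrow> ('m, 'd) tvec) \<Rightarrow> bool" where
  "smooth_normal_field A L I \<eta> P \<longleftrightarrow> smooth_field_along A I \<eta> P \<and>
     (\<forall>t\<in>I. P t \<in> orth_space A L I \<eta> t)"

text \<open>Only the restriction of \<open>E t\<close> to the normal space at \<open>t\<close> is meaningful.\<close>

definition smooth_endo_field ::
  "('m, 'd::finite) chart set \<Rightarrow> (('m, 'd) tvec \<Rightarrow> real) \<Rightarrow> real set \<Rightarrow> (real \<Rightarrow> 'm)
    \<Rightarrow> (real \<Rightarrow> ('m, 'd) tvec \<Rightarrow> ('m, 'd) tvec) \<Rightarrow> bool" where
  "smooth_endo_field A L I \<eta> E \<longleftrightarrow>
     (\<forall>t\<in>I. \<forall>w\<in>orth_space A L I \<eta> t. E t w \<in> orth_space A L I \<eta> t \<and>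
        (\<forall>a. E t (tscale a w) = tscale a (E t w)) \<and>
        (\<forall>u\<in>orth_space A L I \<eta> t. E t (tadd w u) = tadd (E t w) (E t u))) \<and>
     (\<forall>P. smooth_normal_field A L I \<eta> P \<longrightarrow> smooth_field_along A I \<eta> (\<lambda>t. E t (P t)))"

text \<open>\<open>E'\<close> is the covariant derivative of \<open>E\<close>, characterised by \<open>E'(P) = E(P)' - E(P')\<close> for
  all smooth normal fields \<open>P\<close>. Every normal vector extends to such a field, so \<open>E' t\<close>
  is uniquely determined on the normal space.\<close>

definition has_endo_deriv ::
  "('m, 'd::finite) chart set \<Rightarrow> (('m, 'd) tvec \<Rightarrow> real) \<Rightarrow> real set \<Rightarrow> (real \<Rightarrow> 'm)
    \<Rightarrow> (real \<Rightarrow> ('m, 'd) tvec \<Rightarrow> ('m, 'd) tvec)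
    \<Rightarrow> (real \<Rightarrow> ('m, 'd) tvec \<Rightarrow> ('m, 'd) tvec) \<Rightarrow> bool" where
  "has_endo_deriv A L I \<eta> E E' \<longleftrightarrow>
     smooth_endo_field A L I \<eta> E \<and> smooth_endo_field A L I \<eta> E' \<and>
     (\<forall>P. smooth_normal_field A L I \<eta> P \<longrightarrow>
        (\<forall>t\<in>I. E' t (P t) = tadd (cov_deriv A L I \<eta> (\<lambda>s. E s (P s)) t)
                                  (tscale (-1) (E t (cov_deriv A L I \<eta> P t)))))"

definition curv ::
  "('m, 'd::finite) chart set \<Rightarrow> (('m, 'd) tvec \<Rightarrow> real) \<Rightarrow> ('m, 'd) tvec
    \<Rightarrow> ('m, 'd) tvec \<Rightarrow> ('m, 'd) tvec" where
  "curv A L v w = (tbase v, \<lambda>c. if c \<in> charts_at A (tbase v)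
     then (\<chi> \<alpha>. \<Sum>\<beta>\<in>UNIV. Rco (local_rep A L c) \<alpha> \<beta> (tcoords c v) * tcomp w c $ \<beta>)
     else 0)"

definition jacobi_tensor ::
  "('m, 'd::finite) chart set \<Rightarrow> (('m, 'd) tvec \<Rightarrow> real) \<Rightarrow> real set \<Rightarrow> (real \<Rightarrow> 'm)
    \<Rightarrow> (real \<Rightarrow> ('m, 'd) tvec \<Rightarrow> ('m, 'd) tvec) \<Rightarrow> bool" where
  "jacobi_tensor A L I \<eta> J \<longleftrightarrow> (\<exists>J' J''.
     has_endo_deriv A L I \<eta> J J' \<and> has_endo_deriv A L I \<eta> J' J'' \<and>
     (\<forall>t\<in>I. \<forall>w\<in>orth_space A L I \<eta> t.
        tadd (J'' t w) (curv A L (velocity A I \<eta> t) (J t w)) = tzero (\<eta> t)) \<and>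
     (\<forall>t\<in>I. {w \<in> orth_space A L I \<eta> t. J t w = tzero (\<eta> t)} \<inter>
            {w \<in> orth_space A L I \<eta> t. J' t w = tzero (\<eta> t)} = {tzero (\<eta> t)}))"


section \<open>Weighted objects along a geodesic\<close>

definition weight_along ::
  "('m, 'd::finite) chart set \<Rightarrow> real set \<Rightarrow> (real \<Rightarrow> 'm) \<Rightarrow> (('m, 'd) tvec \<Rightarrow> real)
    \<Rightarrow> real \<Rightarrow> real" where
  "weight_along A I \<eta> \<psi> t = \<psi> (velocity A I \<eta> t)"

text \<open>\<open>tau_rate\<close> is \<open>dt/d\<tau>\<close> for the proper time \<open>\<tau>\<close> with parameter \<open>\<epsilon>\<close>; in this section \<open>f\<close>
  stands for the weight along the geodesic.\<close>

definition tau_rate :: "nat \<Rightarrow> real \<Rightarrow> (real \<Rightarrow> real) \<Rightarrow> real \<Rightarrow> real" where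
  "tau_rate n \<epsilon> f t = exp (2 * (1 - \<epsilon>) / real n * f t)"

definition tau_deriv ::
  "nat \<Rightarrow> real \<Rightarrow> (real \<Rightarrow> real) \<Rightarrow> real set \<Rightarrow> (real \<Rightarrow> real) \<Rightarrow> real \<Rightarrow> real" where
  "tau_deriv n \<epsilon> f I h t = tau_rate n \<epsilon> f t * deriv_on I h t"

definition has_endo_tau_deriv ::
  "('m, 'd::finite) chart set \<Rightarrow> (('m, 'd) tvec \<Rightarrow> real) \<Rightarrow> real set \<Rightarrow> (real \<Rightarrow> 'm)
    \<Rightarrow> nat \<Rightarrow> real \<Rightarrow> (real \<Rightarrow> real)
    \<Rightarrow> (real \<Rightarrow> ('m, 'd) tvec \<Rightarrow> ('m, 'd) tvec)
    \<Rightarrow> (real \<Rightarrow> ('m, 'd) tvec \<Rightarrow> ('m, 'd) tvec) \<Rightarrow> bool" where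
  "has_endo_tau_deriv A L I \<eta> n \<epsilon> f E Es \<longleftrightarrow> (\<exists>E'. has_endo_deriv A L I \<eta> E E' \<and>
     (\<forall>t\<in>I. \<forall>w\<in>orth_space A L I \<eta> t. Es t w = tscale (tau_rate n \<epsilon> f t) (E' t w)))"

definition weighted_endo ::
  "nat \<Rightarrow> (real \<Rightarrow> real) \<Rightarrow> (real \<Rightarrow> ('m, 'd::finite) tvec \<Rightarrow> ('m, 'd) tvec)
    \<Rightarrow> real \<Rightarrow> ('m, 'd) tvec \<Rightarrow> ('m, 'd) tvec" where
  "weighted_endo n f J t w = tscale (exp (- f t / real n)) (J t w)"

text \<open>Used for \<open>N \<noteq> n\<close> only.\<close>

definition weighted_curv ::
  "('m, 'd::finite) chart set \<Rightarrow> (('m, 'd) tvec \<Rightarrow> real) \<Rightarrow> real set \<Rightarrow> (real \<Rightarrow> 'm)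
    \<Rightarrow> nat \<Rightarrow> (real \<Rightarrow> real) \<Rightarrow> real \<Rightarrow> real \<Rightarrow> real \<Rightarrow> ('m, 'd) tvec \<Rightarrow> ('m, 'd) tvec" where
  "weighted_curv A L I \<eta> n f N \<epsilon> t w =
     tscale (exp (4 * (1 - \<epsilon>) / real n * f t))
       (tadd (curv A L (velocity A I \<eta> t) w)
         (tscale (1 / real n * (deriv_on I (deriv_on I f) t - (deriv_on I f t)\<^sup>2 / (N - real n))) w))"

end

theory Submission
  imports Defs
begin

text \<open>With \<open>a = exp ((1 - 2\<epsilon>) f / n)\<close> and \<open>f\<close> the weight along the geodesic, the Leibniz rule gives
  \<open>J\<^sub>\<psi>\<^sup>* = a (J' - (f'/n) J)\<close>. Differentiating once more and replacing \<open>J''\<close> by \<open>- R J\<close>, the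
  coefficients of \<open>J'\<close> and of \<open>J\<close> in the asserted equation cancel. The analytic content is that \<open>f\<close>
  is smooth and that the covariant derivative obeys the Leibniz rule.\<close>

section \<open>Calculus of smooth functions\<close>

text \<open>The interval may contain its end points, so time derivatives are taken within
  \<open>I\<close> and smoothness there means having local smooth extensions. Calculus is therefore
  done with \<open>Ck_on\<close> on open sets and carried over to \<open>smooth_on\<close> through
  extensions; a derivative within \<open>I\<close> is read off from an extension, which is
  legitimate because no point of \<open>I\<close> is isolated. The weight \<psi> is smooth only on
  the closed future cones without zero, in bundle coordinates, so smoothness of \<open>f\<close>
  requires that the velocity, given by its chart-wise derivatives, is a genuine tangent vector in
  that set. The Jacobi hypothesis supplies \<open>J'\<close> and \<open>J''\<close>.
  Differentiability of the weighted tensor thus reduces to closure of \<open>has_endo_deriv\<close>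
  under sums and under scaling by smooth functions, and what remains is a polynomial identity in the
  coefficients. The exponent in \<open>a\<close> is the sum of 2(1 - \<epsilon>), from dt/d\<tau>,
  and -1, from the weight. The choice N = 0 turns the quadratic term of the weighted curvature into
  + f'^2/n, the sign required for the cancellation.\<close>

lemma differentiable_transform_open:
  "f differentiable (at x) \<Longrightarrow> open U \<Longrightarrow> x \<in> U \<Longrightarrow> (\<And>y. y \<in> U \<Longrightarrow> f y = g y) \<Longrightarrow> g differentiable (at x)"
  unfolding differentiable_def using has_derivative_transform_within_open by blast

text \<open>In an open set, equality on the set is equality near each point, so the Frechet
  derivatives agree there and the induction passes to every directional derivative.\<close>

lemma Ck_on_cong:
  assumes "open U" "\<And>x. x \<in> U \<Longrightarrow> f x = g x"
  shows "Ck_on k U f \<longleftrightarrow> Ck_on k U g"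
proof -
  have imp: "Ck_on k U g" if "Ck_on k U f" "\<And>x. x \<in> U \<Longrightarrow> f x = g x" for f g
    using that
  proof (induction k arbitrary: f g)
    case 0
    then show ?case by (auto intro: continuous_on_eq)
  next
    case (Suc k)
    have "g differentiable (at x)" if "x \<in> U" for x
      using Suc.prems that assms(1) by (auto intro: differentiable_transform_open)
    moreover have "Ck_on k U (\<lambda>x. frechet_derivative g (at x) h)" for h
    proof (rule Suc.IH)
      show "Ck_on k U (\<lambda>x. frechet_derivative f (at x) h)" using Suc.prems by simp
      show "frechet_derivative f (at x) h = frechet_derivative g (at x) h" if "x \<in> U" for x
        using frechet_derivative_transform_within_open[of f x U g] Suc.prems that assms(1) by auto
    qed
    ultimately show ?case by simp
  qed
  show ?thesis using imp[of f g] imp[of g f] assms(2) by auto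
qed

lemma Ck_on_subset: "Ck_on k U f \<Longrightarrow> V \<subseteq> U \<Longrightarrow> Ck_on k V f"
  by (induction k arbitrary: f) (auto intro: continuous_on_subset)

lemma Ck_on_SucD: "Ck_on (Suc k) U f \<Longrightarrow> Ck_on k U f"
proof (induction k arbitrary: f)
  case 0
  then show ?case
    by (auto intro!: continuous_at_imp_continuous_on differentiable_imp_continuous_within)
next
  case (Suc k)
  then show ?case using Ck_on.simps(2) by blast
qed

text \<open>Lets an explicit derivative formula stand in for \<open>frechet_derivative\<close>; the
  inductive steps below all enter the next order of smoothness this way.\<close>

lemma Ck_on_SucI:
  assumes "open U" "\<And>x. x \<in> U \<Longrightarrow> (f has_derivative f' x) (at x)" "\<And>h. Ck_on k U (\<lambda>x. f' x h)"
  shows "Ck_on (Suc k) U f"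
proof -
  have "frechet_derivative f (at x) = f' x" if "x \<in> U" for x
    using frechet_derivative_at assms(2) that by metis
  then have "Ck_on k U (\<lambda>x. frechet_derivative f (at x) h)" for h
    using Ck_on_cong[OF assms(1), of "\<lambda>x. f' x h" "\<lambda>x. frechet_derivative f (at x) h" k]
      assms(3)[of h] by metis
  moreover have "f differentiable (at x)" if "x \<in> U" for x
    using assms(2)[OF that] by (auto simp: differentiable_def)
  ultimately show ?thesis by simp
qed

lemma Ck_on_has_derivative:
  "Ck_on (Suc k) U f \<Longrightarrow> x \<in> U \<Longrightarrow> (f has_derivative frechet_derivative f (at x)) (at x)"
  by (simp add: frechet_derivative_works)

lemma Ck_on_const: "open U \<Longrightarrow> Ck_on k U (\<lambda>x. c)"
proof (induction k arbitrary: c)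
  case (Suc k)
  then show ?case by (intro Ck_on_SucI[where f' = "\<lambda>x h. 0"]) auto
qed simp

lemma Ck_on_add:
  "open U \<Longrightarrow> Ck_on k U f \<Longrightarrow> Ck_on k U g \<Longrightarrow> Ck_on k U (\<lambda>x. f x + g x)"
proof (induction k arbitrary: f g)
  case 0
  then show ?case by (simp add: continuous_on_add)
next
  case (Suc k)
  show ?case
    by (rule Ck_on_SucI[OF _ has_derivative_add[OF Ck_on_has_derivative Ck_on_has_derivative]])
      (use Suc in auto)
qed

lemma Ck_on_sum:
  "open U \<Longrightarrow> (\<And>i. i \<in> B \<Longrightarrow> Ck_on k U (f i)) \<Longrightarrow> Ck_on k U (\<lambda>x. \<Sum>i\<in>B. f i x)"
  by (induction B rule: infinite_finite_induct) (auto intro: Ck_on_add Ck_on_const)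

lemma (in bounded_linear) Ck_on:
  "open U \<Longrightarrow> Ck_on k U g \<Longrightarrow> Ck_on k U (\<lambda>x. f (g x))"
proof (induction k arbitrary: g)
  case 0
  then show ?case by (simp add: continuous_on)
next
  case (Suc k)
  show ?case
    by (rule Ck_on_SucI[OF _ has_derivative[OF Ck_on_has_derivative]]) (use Suc in auto)
qed

lemma (in bounded_bilinear) Ck_on:
  "open U \<Longrightarrow> Ck_on k U f \<Longrightarrow> Ck_on k U g \<Longrightarrow> Ck_on k U (\<lambda>x. prod (f x) (g x))"
proof (induction k arbitrary: f g)
  case 0
  then show ?case by (simp add: continuous_on)
next
  case (Suc k)
  \<comment> \<open>The product rule multiplies each derivative by the other factor
    undifferentiated, so the factors themselves are needed at order \<open>k\<close> too.\<close>
  have "Ck_on k U f" "Ck_on k U g" using Suc.prems Ck_on_SucD by blast+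
  with Suc show ?case
    by (intro Ck_on_SucI[OF _ FDERIV[OF Ck_on_has_derivative Ck_on_has_derivative]] Ck_on_add Suc.IH)
      auto
qed

text \<open>\<open>Ck_on\<close> controls derivatives only in fixed directions, whereas in the chain
  rule the direction fed to the derivative of \<open>f\<close> moves with \<open>x\<close>.
  Expanding it over \<open>Basis\<close> leaves scalar coefficients times derivatives of
  \<open>f\<close> in fixed directions composed with \<open>g\<close>, and to the latter the
  induction hypothesis applies.\<close>

lemma Ck_on_compose:
  fixes f :: "'b::euclidean_space \<Rightarrow> 'c::real_normed_vector" and g :: "'a::euclidean_space \<Rightarrow> 'b"
  shows "open U \<Longrightarrow> open W \<Longrightarrow> g ` U \<subseteq> W \<Longrightarrow> Ck_on k U g \<Longrightarrow> Ck_on k W f \<Longrightarrow> Ck_on k U (\<lambda>x. f (g x))"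
proof (induction k arbitrary: f)
  case 0
  then show ?case by (auto intro: continuous_on_compose2)
next
  case (Suc k)
  let ?g' = "\<lambda>x. frechet_derivative g (at x)" and ?f' = "\<lambda>y. frechet_derivative f (at y)"
  have gk: "Ck_on k U g" using Suc.prems Ck_on_SucD by blast
  have deriv: "((\<lambda>x. f (g x)) has_derivative (\<lambda>h. \<Sum>b\<in>Basis. (?g' x h \<bullet> b) *\<^sub>R ?f' (g x) b)) (at x)"
    if "x \<in> U" for x
  proof -
    have f': "(f has_derivative ?f' (g x)) (at (g x))"
      using Suc.prems that by (intro Ck_on_has_derivative) auto
    then have "linear (?f' (g x))" by (rule has_derivative_linear)
    then have eq: "?f' (g x) (\<Sum>b\<in>Basis. (y \<bullet> b) *\<^sub>R b) = (\<Sum>b\<in>Basis. (y \<bullet> b) *\<^sub>R ?f' (g x) b)" for y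
      by (simp only: linear_sum linear_scale)
    have "(\<lambda>h. ?f' (g x) (?g' x h)) = (\<lambda>h. \<Sum>b\<in>Basis. (?g' x h \<bullet> b) *\<^sub>R ?f' (g x) b)"
      using eq[unfolded euclidean_representation] by (intro ext)
    moreover have "((\<lambda>x. f (g x)) has_derivative (\<lambda>h. ?f' (g x) (?g' x h))) (at x)"
      using Suc.prems that
      by (intro has_derivative_compose[of g _ x UNIV f, OF _ f'] Ck_on_has_derivative) auto
    ultimately show ?thesis by (simp only:)
  qed
  have "Ck_on k U (\<lambda>x. \<Sum>b\<in>Basis. (?g' x h \<bullet> b) *\<^sub>R ?f' (g x) b)" for h
    using Suc.prems gk
    by (intro Ck_on_sum bounded_bilinear.Ck_on[OF bounded_bilinear_scaleR]
        bounded_linear.Ck_on[OF bounded_linear_inner_left] Suc.IH) auto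
  with deriv show ?case using Suc.prems(1) by (intro Ck_on_SucI)
qed

lemma Ck_on_exp: "Ck_on k UNIV (exp :: real \<Rightarrow> real)"
proof (induction k)
  case 0
  show ?case by (simp add: continuous_on_exp)
next
  case (Suc k)
  show ?case
  proof (rule Ck_on_SucI)
    show "(exp has_derivative (\<lambda>h. exp x * h)) (at x)" for x :: real
      using DERIV_exp[of x] by (simp add: has_field_derivative_def)
    show "Ck_on k UNIV (\<lambda>x::real. exp x * h)" for h
      using Suc by (intro bounded_linear.Ck_on[OF bounded_linear_mult_left]) auto
  qed simp
qed

section \<open>Smoothness on arbitrary sets by local extensions\<close>

lemma smooth_onI:
  assumes "\<And>x. x \<in> S \<Longrightarrow> \<exists>U g. open U \<and> x \<in> U \<and> (\<forall>k. Ck_on k U g) \<and> (\<forall>y\<in>U \<inter> S. g y = f y)"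
  shows "smooth_on S f"
  using assms by (auto simp: smooth_on_def)

lemma smooth_onE:
  assumes "smooth_on S f" "x \<in> S"
  obtains U g where "open U" "x \<in> U" "\<And>k. Ck_on k U g" "\<And>y. y \<in> U \<Longrightarrow> y \<in> S \<Longrightarrow> g y = f y"
  using assms unfolding smooth_on_def by (metis IntI)

lemma smooth_on_cong: "smooth_on S f \<Longrightarrow> (\<And>x. x \<in> S \<Longrightarrow> f x = g x) \<Longrightarrow> smooth_on S g"
  unfolding smooth_on_def by (metis IntD2)

lemma smooth_on_subset:
  assumes "smooth_on S f" "V \<subseteq> S"
  shows "smooth_on V f"
proof (rule smooth_onI)
  fix x assume "x \<in> V"
  then have "x \<in> S" using assms(2) by auto
  then show "\<exists>U g. open U \<and> x \<in> U \<and> (\<forall>k. Ck_on k U g) \<and> (\<forall>y\<in>U \<inter> V. g y = f y)"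
    by (rule smooth_onE[OF assms(1)]) (use assms(2) in blast)
qed

text \<open>A relatively open \<open>V\<close> is the trace of an open \<open>W\<close>; cutting the
  domain of an extension down to \<open>W\<close> makes it agree with \<open>f\<close> on all of
  \<open>S\<close> there. This pastes statements proved chart by chart.\<close>

lemma smooth_on_locally:
  assumes "\<And>x. x \<in> S \<Longrightarrow> \<exists>V. openin (top_of_set S) V \<and> x \<in> V \<and> smooth_on V f"
  shows "smooth_on S f"
proof (rule smooth_onI)
  fix x assume "x \<in> S"
  then obtain V where V: "openin (top_of_set S) V" "x \<in> V" "smooth_on V f" using assms by blast
  then obtain W where W: "open W" "V = S \<inter> W" by (auto simp: openin_open)
  obtain U g where U: "open U" "x \<in> U" "\<And>k. Ck_on k U g" "\<And>y. y \<in> U \<Longrightarrow> y \<in> V \<Longrightarrow> g y = f y"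
    by (rule smooth_onE[OF V(3,2)]) blast
  have "open (U \<inter> W)" "x \<in> U \<inter> W" "\<forall>y\<in>(U \<inter> W) \<inter> S. g y = f y" "Ck_on k (U \<inter> W) g" for k
    using U V W by (auto intro: Ck_on_subset)
  then show "\<exists>U g. open U \<and> x \<in> U \<and> (\<forall>k. Ck_on k U g) \<and> (\<forall>y\<in>U \<inter> S. g y = f y)" by blast
qed

text \<open>Two extensions are combined on the intersection of their domains. The argument is the
  same for sums, products and pairs, hence the general \<open>p\<close>.\<close>

lemma smooth_on_binop:
  fixes S :: "'a::euclidean_space set" and f :: "'a \<Rightarrow> 'b::real_normed_vector"
    and g :: "'a \<Rightarrow> 'c::real_normed_vector" and p :: "'b \<Rightarrow> 'c \<Rightarrow> 'e::real_normed_vector"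
  assumes op: "\<And>k U (f :: 'a \<Rightarrow> 'b) g. open U \<Longrightarrow> Ck_on k U f \<Longrightarrow> Ck_on k U g \<Longrightarrow> Ck_on k U (\<lambda>x. p (f x) (g x))"
    and f: "smooth_on S f" and g: "smooth_on S g"
  shows "smooth_on S (\<lambda>x. p (f x) (g x))"
proof (rule smooth_onI)
  fix x assume x: "x \<in> S"
  obtain U f1 where U: "open U" "x \<in> U" "\<And>k. Ck_on k U f1" "\<And>y. y \<in> U \<Longrightarrow> y \<in> S \<Longrightarrow> f1 y = f y"
    by (rule smooth_onE[OF f x]) blast
  obtain V g1 where V: "open V" "x \<in> V" "\<And>k. Ck_on k V g1" "\<And>y. y \<in> V \<Longrightarrow> y \<in> S \<Longrightarrow> g1 y = g y"
    by (rule smooth_onE[OF g x]) blast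
  have "Ck_on k (U \<inter> V) (\<lambda>x. p (f1 x) (g1 x))" for k
    using U(1,3) V(1,3) by (intro op) (auto intro: Ck_on_subset)
  then show "\<exists>U h. open U \<and> x \<in> U \<and> (\<forall>k. Ck_on k U h) \<and> (\<forall>y\<in>U \<inter> S. h y = p (f y) (g y))"
    using U V by (intro exI[of _ "U \<inter> V"] exI[of _ "\<lambda>x. p (f1 x) (g1 x)"]) auto
qed

lemma smooth_on_add: "smooth_on S f \<Longrightarrow> smooth_on S g \<Longrightarrow> smooth_on S (\<lambda>x. f x + g x)"
  by (rule smooth_on_binop[where p = "(+)"]) (rule Ck_on_add)

lemma (in bounded_bilinear) smooth_on:
  "smooth_on S f \<Longrightarrow> smooth_on S g \<Longrightarrow> smooth_on S (\<lambda>x. prod (f x) (g x))"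
  by (rule smooth_on_binop[where p = prod]) (rule Ck_on)

lemmas smooth_on_scaleR = bounded_bilinear.smooth_on[OF bounded_bilinear_scaleR]
  and smooth_on_mult = bounded_bilinear.smooth_on[OF bounded_bilinear_mult]

lemma smooth_on_const: "smooth_on S (\<lambda>x. c)"
  by (intro smooth_onI exI[of _ UNIV] exI[of _ "\<lambda>x. c"]) (auto intro: Ck_on_const)

lemma smooth_on_Pair: "smooth_on S f \<Longrightarrow> smooth_on S g \<Longrightarrow> smooth_on S (\<lambda>x. (f x, g x))"
proof (rule smooth_on_binop[where p = Pair])
  fix k and U :: "'a set" and f :: "'a \<Rightarrow> 'b" and g :: "'a \<Rightarrow> 'c"
  assume *: "open U" "Ck_on k U f" "Ck_on k U g"
  \<comment> \<open>Pairing is not bilinear, but it is the sum of two bounded linear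
    embeddings.\<close>
  have "Ck_on k U (\<lambda>x. (f x, 0) + (0, g x))"
    using * by (intro Ck_on_add bounded_linear.Ck_on[of "\<lambda>y. (y, 0)"] bounded_linear.Ck_on[of "\<lambda>y. (0, y)"])
      (auto intro!: bounded_linear_Pair bounded_linear_ident bounded_linear_zero)
  then show "Ck_on k U (\<lambda>x. (f x, g x))" by simp
qed

lemma smooth_on_compose:
  fixes f :: "'b::euclidean_space \<Rightarrow> 'c::real_normed_vector" and g :: "'a::euclidean_space \<Rightarrow> 'b"
  assumes f: "smooth_on W f" and g: "smooth_on S g" and sub: "g ` S \<subseteq> W"
  shows "smooth_on S (\<lambda>x. f (g x))"
proof (rule smooth_onI)
  fix x assume x: "x \<in> S"
  obtain U g1 where U: "open U" "x \<in> U" "\<And>k. Ck_on k U g1" "\<And>y. y \<in> U \<Longrightarrow> y \<in> S \<Longrightarrow> g1 y = g y"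
    by (rule smooth_onE[OF g x]) blast
  obtain V f1 where V: "open V" "g x \<in> V" "\<And>k. Ck_on k V f1" "\<And>y. y \<in> V \<Longrightarrow> y \<in> W \<Longrightarrow> f1 y = f y"
    by (rule smooth_onE[OF f, of "g x"]) (use sub x in blast)+
  have "continuous_on U g1" using U(3)[of 0] by simp
  \<comment> \<open>The extension \<open>g1\<close> may leave \<open>V\<close>, even where
    \<open>g\<close> does not, so the composite extension lives on the preimage. At points of
    \<open>S\<close> it still equals \<open>f (g y)\<close>, since there \<open>g1\<close> agrees
    with \<open>g\<close> and lands in \<open>W\<close>.\<close>
  then have op: "open (U \<inter> g1 -` V)" using U V continuous_open_preimage by blast
  have "Ck_on k (U \<inter> g1 -` V) (\<lambda>x. f1 (g1 x))" for k
    using op V(1,3) Ck_on_subset[OF U(3)[of k], of "U \<inter> g1 -` V"]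
    by (intro Ck_on_compose[OF op V(1) _ _ V(3)]) auto
  then show "\<exists>U h. open U \<and> x \<in> U \<and> (\<forall>k. Ck_on k U h) \<and> (\<forall>y\<in>U \<inter> S. h y = f (g y))"
    using op U(2) V(2) U(4)[OF U(2) x] U(4) V(4) x sub
    by (intro exI[of _ "U \<inter> g1 -` V"] exI[of _ "\<lambda>x. f1 (g1 x)"] conjI allI ballI) (simp, simp, blast, force)
qed

lemma smooth_on_exp: "smooth_on S f \<Longrightarrow> smooth_on S (\<lambda>x. exp (f x :: real))"
proof (rule smooth_on_compose[of UNIV exp])
  show "smooth_on UNIV (exp :: real \<Rightarrow> real)"
    using Ck_on_exp by (intro smooth_onI exI[of _ UNIV] exI[of _ exp]) simp
qed auto

lemma smooth_on_open_differentiable: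
  assumes "smooth_on S f" "open S" "x \<in> S"
  shows "f differentiable (at x)"
proof -
  obtain U g where U: "open U" "x \<in> U" "\<And>k. Ck_on k U g" "\<And>y. y \<in> U \<Longrightarrow> y \<in> S \<Longrightarrow> g y = f y"
    by (rule smooth_onE[OF assms(1,3)]) blast
  have "g differentiable (at x)" using U(2) U(3)[of "Suc 0"] by simp
  then show ?thesis
    using U assms by (intro differentiable_transform_open[of g x "U \<inter> S" f]) auto
qed

text \<open>The derivative of an extension in direction 1 is a derivative of \<open>f\<close> within
  \<open>I\<close>: as \<open>S\<close> is relatively open in \<open>I\<close>, extension and
  \<open>f\<close> agree at all nearby points of \<open>I\<close>. Non-isolation makes it the only
  one, so this same function extends \<open>deriv_on I f\<close> smoothly, also at end
  points.\<close>

lemma smooth_on_deriv_on: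
  assumes f: "smooth_on S f" and S: "openin (top_of_set I) S"
    and nontriv: "\<And>t. t \<in> I \<Longrightarrow> at t within I \<noteq> bot"
  shows "smooth_on S (deriv_on I f)"
    and "t \<in> S \<Longrightarrow> (f has_vector_derivative deriv_on I f t) (at t within I)"
proof -
  obtain W where W: "open W" "S = I \<inter> W" using S by (auto simp: openin_open)
  have *: "(f has_vector_derivative frechet_derivative g (at t) 1) (at t within I)"
    if U: "open U" "t \<in> U" "\<And>k. Ck_on k U g" "\<And>y. y \<in> U \<Longrightarrow> y \<in> S \<Longrightarrow> g y = f y" and "t \<in> S" for t U g
  proof -
    have "g differentiable (at t)" using U(2) U(3)[of "Suc 0"] by simp
    then have "(g has_vector_derivative frechet_derivative g (at t) 1) (at t)"
      by (simp add: frechet_derivative_eq_vector_derivative vector_derivative_works)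
    then have "(g has_vector_derivative frechet_derivative g (at t) 1) (at t within I)"
      by (rule has_vector_derivative_at_within)
    then show ?thesis
      unfolding has_vector_derivative_def
      by (rule has_derivative_transform_eventually)
         (use U W \<open>t \<in> S\<close> in \<open>auto simp: eventually_at_topological intro!: exI[of _ "U \<inter> W"]\<close>)
  qed
  show "(f has_vector_derivative deriv_on I f t) (at t within I)" if t: "t \<in> S" for t
  proof -
    obtain U g where U: "open U" "t \<in> U" "\<And>k. Ck_on k U g" "\<And>y. y \<in> U \<Longrightarrow> y \<in> S \<Longrightarrow> g y = f y"
      by (rule smooth_onE[OF f t]) blast
    from *[OF U t] show ?thesis
      using vector_derivative_within[OF nontriv, of t f] t W(2) by auto
  qed
  show "smooth_on S (deriv_on I f)"
  proof (rule smooth_onI)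
    fix x assume x: "x \<in> S"
    obtain U g where U: "open U" "x \<in> U" "\<And>k. Ck_on k U g" "\<And>y. y \<in> U \<Longrightarrow> y \<in> S \<Longrightarrow> g y = f y"
      by (rule smooth_onE[OF f x]) blast
    have "Ck_on k U (\<lambda>x. frechet_derivative g (at x) 1)" for k using U(3)[of "Suc k"] by simp
    moreover have "frechet_derivative g (at y) 1 = deriv_on I f y" if "y \<in> U \<inter> S" for y
      using *[OF U(1) _ U(3,4), of y] that W(2) nontriv vector_derivative_within[of y I f] by auto
    ultimately show "\<exists>U g. open U \<and> x \<in> U \<and> (\<forall>k. Ck_on k U g) \<and> (\<forall>y\<in>U \<inter> S. g y = deriv_on I f y)"
      using U(1,2) by (intro exI[of _ U] exI[of _ "\<lambda>x. frechet_derivative g (at x) 1"]) auto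
  qed
qed

section \<open>Curves in a manifold\<close>

lemma tangent_spaceI:
  assumes "tbase v = p"
    and "\<And>c c'. c \<in> charts_at A p \<Longrightarrow> c' \<in> charts_at A p \<Longrightarrow>
      tcomp v c' = frechet_derivative (cmap c' \<circ> cinv c) (at (cmap c p)) (tcomp v c)"
    and "\<And>c. c \<notin> charts_at A p \<Longrightarrow> tcomp v c = 0"
  shows "v \<in> tangent_space A p"
  unfolding tangent_space_def using assms by blast

lemma tangent_space_base: "v \<in> tangent_space A p \<Longrightarrow> tbase v = p"
  by (simp add: tangent_space_def)

lemma tangent_space_transition:
  "v \<in> tangent_space A p \<Longrightarrow> c \<in> charts_at A p \<Longrightarrow> c' \<in> charts_at A p \<Longrightarrow>
    tcomp v c' = frechet_derivative (cmap c' \<circ> cinv c) (at (cmap c p)) (tcomp v c)"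
  unfolding tangent_space_def by blast

lemma tangent_space_outside: "v \<in> tangent_space A p \<Longrightarrow> c \<notin> charts_at A p \<Longrightarrow> tcomp v c = 0"
  unfolding tangent_space_def by blast

locale curve_in_manifold =
  fixes T :: "'m topology" and A :: "('m, 'd::finite) chart set" and I :: "real set" and \<eta> :: "real \<Rightarrow> 'm"
  assumes manifold: "smooth_manifold T A"
    and curve: "smooth_curve T A I \<eta>"
    and interval: "is_interval I" and interior: "interior I \<noteq> {}"
begin

text \<open>A set with nonempty interior is infinite, and a connected set other than a singleton has
  no isolated points.\<close>

lemma at_within_nontrivial: "t \<in> I \<Longrightarrow> at t within I \<noteq> bot"
proof -
  assume t: "t \<in> I"
  have "infinite I"
    using interior empty_interior_finite by blast
  then have "\<not> (\<exists>x. I = {x})" by auto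
  then have "t islimpt I"
    using connected_imp_perfect[of I t] interval t by (auto simp: is_interval_connected_1)
  then show ?thesis by (simp add: trivial_limit_within)
qed

lemma openin_cdom: "c \<in> A \<Longrightarrow> openin T (cdom c)"
  using manifold by (simp add: smooth_manifold_def)

lemma in_topspace: "t \<in> I \<Longrightarrow> \<eta> t \<in> topspace T"
  using curve by (auto simp: smooth_curve_def continuous_map_def)

lemma openin_chart_times: "c \<in> A \<Longrightarrow> openin (top_of_set I) {t \<in> I. \<eta> t \<in> cdom c}"
  using openin_continuous_map_preimage[of "top_of_set I" T \<eta> "cdom c"] curve openin_cdom
  by (simp add: smooth_curve_def)

lemma chart_exists:
  assumes "t \<in> I"
  obtains c where "c \<in> A" "\<eta> t \<in> cdom c"
proof -
  have "(\<Union>c\<in>A. cdom c) = topspace T" using manifold by (simp add: smooth_manifold_def)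
  then show thesis using in_topspace[OF assms] that by blast
qed

lemma homeomorphic_cmap:
  "c \<in> A \<Longrightarrow> homeomorphic_map (subtopology T (cdom c)) (top_of_set (cimage c)) (cmap c)"
  using manifold by (simp add: smooth_manifold_def)

lemma cinv_cmap:
  assumes "c \<in> A" "p \<in> cdom c"
  shows "cinv c (cmap c p) = p"
proof -
  have "topspace (subtopology T (cdom c)) = cdom c"
    using openin_subset[OF openin_cdom[OF assms(1)]] by auto
  then have "inj_on (cmap c) (cdom c)"
    using homeomorphic_imp_injective_map[OF homeomorphic_cmap[OF assms(1)]] by simp
  then show ?thesis unfolding cinv_def using assms(2) by simp
qed

text \<open>Smoothness by extension yields a derivative at the point only if the domain is open. The
  chart map is an open map onto an open set, so the image of the overlap is open.\<close>

lemma transition_differentiable: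
  assumes "c \<in> charts_at A p" "c' \<in> charts_at A p"
  shows "(cmap c' \<circ> cinv c) differentiable (at (cmap c p))"
proof (rule smooth_on_open_differentiable)
  have c: "c \<in> A" "c' \<in> A" "p \<in> cdom c" "p \<in> cdom c'" using assms by (auto simp: charts_at_def)
  show "smooth_on (cmap c ` (cdom c \<inter> cdom c')) (cmap c' \<circ> cinv c)"
    using manifold c by (simp add: smooth_manifold_def)
  have "openin (subtopology T (cdom c)) (cdom c \<inter> cdom c')"
    using openin_subtopology_Int[OF openin_cdom[OF c(2)], of "cdom c"] by (simp add: Int_commute)
  then have "openin (top_of_set (cimage c)) (cmap c ` (cdom c \<inter> cdom c'))"
    using homeomorphic_imp_open_map[OF homeomorphic_cmap[OF c(1)]] by (simp add: open_map_def)
  moreover have "open (cimage c)" using manifold c by (simp add: smooth_manifold_def)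
  ultimately show "open (cmap c ` (cdom c \<inter> cdom c'))" using openin_open_trans by blast
  show "cmap c p \<in> cmap c ` (cdom c \<inter> cdom c')" using c by auto
qed

lemma linear_transition:
  assumes "c \<in> charts_at A p" "c' \<in> charts_at A p"
  shows "linear (frechet_derivative (cmap c' \<circ> cinv c) (at (cmap c p)))"
  using transition_differentiable[OF assms] by (rule linear_frechet_derivative)

lemma tadd_in_tangent_space:
  assumes v: "v \<in> tangent_space A p" and w: "w \<in> tangent_space A p"
  shows "tadd v w \<in> tangent_space A p"
proof (rule tangent_spaceI)
  fix c c' assume c: "c \<in> charts_at A p" "c' \<in> charts_at A p"
  show "tcomp (tadd v w) c' = frechet_derivative (cmap c' \<circ> cinv c) (at (cmap c p)) (tcomp (tadd v w) c)"
    by (simp only: tadd_def snd_conv linear_add[OF linear_transition[OF c]]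
        tangent_space_transition[OF v c, symmetric] tangent_space_transition[OF w c, symmetric])
qed (use assms in \<open>auto simp: tadd_def tangent_space_base tangent_space_outside\<close>)

lemma tscale_in_tangent_space:
  assumes v: "v \<in> tangent_space A p"
  shows "tscale a v \<in> tangent_space A p"
proof (rule tangent_spaceI)
  fix c c' assume c: "c \<in> charts_at A p" "c' \<in> charts_at A p"
  show "tcomp (tscale a v) c' = frechet_derivative (cmap c' \<circ> cinv c) (at (cmap c p)) (tcomp (tscale a v) c)"
    by (simp only: tscale_def snd_conv linear_scale[OF linear_transition[OF c]]
        tangent_space_transition[OF v c, symmetric])
qed (use assms in \<open>auto simp: tscale_def tangent_space_base tangent_space_outside\<close>)

lemma smooth_chart_curve:
  "c \<in> A \<Longrightarrow> smooth_on {t \<in> I. \<eta> t \<in> cdom c} (\<lambda>t. cmap c (\<eta> t))"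
  using curve by (simp add: smooth_curve_def)

text \<open>The components transform by the chain rule. Composing the coordinate change with the
  curve in chart \<open>c\<close> gives the curve in chart \<open>c'\<close> only while the curve
  stays in \<open>cdom c\<close>; these times form a relative neighbourhood of \<open>t\<close>,
  which suffices for derivatives within \<open>I\<close>.\<close>

lemma velocity_in_tangent_space:
  assumes t: "t \<in> I"
  shows "velocity A I \<eta> t \<in> tangent_space A (\<eta> t)"
proof -
  have "deriv_on I (\<lambda>s. cmap c' (\<eta> s)) t
      = frechet_derivative (cmap c' \<circ> cinv c) (at (cmap c (\<eta> t))) (deriv_on I (\<lambda>s. cmap c (\<eta> s)) t)"
    if c: "c \<in> charts_at A (\<eta> t)" and c': "c' \<in> charts_at A (\<eta> t)" for c c'
  proof -
    let ?\<phi> = "cmap c' \<circ> cinv c"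
    let ?D = "frechet_derivative ?\<phi> (at (cmap c (\<eta> t)))"
    have cA: "c \<in> A" "\<eta> t \<in> cdom c" and c'A: "c' \<in> A" using c c' by (auto simp: charts_at_def)
    have "((\<lambda>s. cmap c (\<eta> s)) has_vector_derivative deriv_on I (\<lambda>s. cmap c (\<eta> s)) t) (at t within I)"
      using smooth_on_deriv_on(2)[OF smooth_chart_curve openin_chart_times at_within_nontrivial] cA t
      by simp
    moreover have "(?\<phi> has_derivative ?D) (at (cmap c (\<eta> t)))"
      using transition_differentiable[OF c c'] by (simp add: frechet_derivative_works)
    ultimately have "((\<lambda>s. ?\<phi> (cmap c (\<eta> s))) has_derivative
        (\<lambda>h. ?D (h *\<^sub>R deriv_on I (\<lambda>s. cmap c (\<eta> s)) t))) (at t within I)"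
      unfolding has_vector_derivative_def by (rule has_derivative_compose)
    then have "((\<lambda>s. ?\<phi> (cmap c (\<eta> s))) has_vector_derivative
        ?D (deriv_on I (\<lambda>s. cmap c (\<eta> s)) t)) (at t within I)"
      unfolding has_vector_derivative_def by (simp add: linear_scale[OF linear_transition[OF c c']])
    moreover obtain W where "open W" "{s \<in> I. \<eta> s \<in> cdom c} = I \<inter> W"
      using openin_chart_times[OF cA(1)] by (auto simp: openin_open)
    then have "open W" "t \<in> W" "\<And>s. s \<in> W \<Longrightarrow> s \<in> I \<Longrightarrow> \<eta> s \<in> cdom c" using cA t by blast+
    then have "eventually (\<lambda>s. ?\<phi> (cmap c (\<eta> s)) = cmap c' (\<eta> s)) (at t within I)"
      unfolding eventually_at_topological using cinv_cmap[OF cA(1)]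
      by (intro exI[of _ W]) auto
    moreover have "?\<phi> (cmap c (\<eta> t)) = cmap c' (\<eta> t)" using cA cinv_cmap by simp
    ultimately have "((\<lambda>s. cmap c' (\<eta> s)) has_vector_derivative
        ?D (deriv_on I (\<lambda>s. cmap c (\<eta> s)) t)) (at t within I)"
      unfolding has_vector_derivative_def
      by (rule has_derivative_transform_eventually[OF _ _ _ t])
    then show ?thesis using vector_derivative_within at_within_nontrivial[OF t] by blast
  qed
  note chain = this
  show ?thesis
  proof (rule tangent_spaceI)
    fix c c' assume c: "c \<in> charts_at A (\<eta> t)" "c' \<in> charts_at A (\<eta> t)"
    then show "tcomp (velocity A I \<eta> t) c'
        = frechet_derivative (cmap c' \<circ> cinv c) (at (cmap c (\<eta> t))) (tcomp (velocity A I \<eta> t) c)"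
      using chain[OF c] by (simp only: velocity_def snd_conv if_True)
  qed (simp_all add: velocity_def)
qed

text \<open>Components in one chart determine those in all charts at the point by the transition
  law, and the zero convention fixes the remaining entries.\<close>

lemma tvec_of_tcoords:
  assumes "c \<in> A" "t \<in> I" "\<eta> t \<in> cdom c" "v \<in> tangent_space A (\<eta> t)"
  shows "tvec_of A c (tcoords c v) = v"
proof -
  have v: "tbase v = \<eta> t" using assms(4) by (rule tangent_space_base)
  have c: "c \<in> charts_at A (\<eta> t)" using assms by (simp add: charts_at_def)
  have "cinv c (cmap c (\<eta> t)) = \<eta> t" using cinv_cmap assms by blast
  moreover have "(if c' \<in> charts_at A (\<eta> t) then
      frechet_derivative (cmap c' \<circ> cinv c) (at (cmap c (\<eta> t))) (tcomp v c) else 0) = tcomp v c'" for c'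
    using tangent_space_transition[OF assms(4) c, of c'] tangent_space_outside[OF assms(4), of c'] by simp
  ultimately show ?thesis unfolding tvec_of_def tcoords_def by (intro prod_eqI ext) (simp_all add: v)
qed

text \<open>In a chart the velocity has coordinates consisting of the curve and its derivative, both
  smooth in time; composing with the local representative of \<open>f\<close> gives the claim near
  each time.\<close>

lemma smooth_bundle_function_velocity:
  assumes f: "smooth_on_bundle A W f" and W: "\<And>t. t \<in> I \<Longrightarrow> velocity A I \<eta> t \<in> W"
  shows "smooth_on I (\<lambda>t. f (velocity A I \<eta> t))"
proof (rule smooth_on_locally)
  fix t assume "t \<in> I"
  then obtain c where c: "c \<in> A" "\<eta> t \<in> cdom c" by (rule chart_exists)
  define S where "S = {s \<in> I. \<eta> s \<in> cdom c}"
  define z where "z s = tcoords c (velocity A I \<eta> s)" for s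
  have vec: "tvec_of A c (z s) = velocity A I \<eta> s" if "s \<in> S" for s
    unfolding z_def
    using that c(1) by (intro tvec_of_tcoords[of _ s] velocity_in_tangent_space) (auto simp: S_def)
  have "smooth_on S (\<lambda>s. (cmap c (\<eta> s), deriv_on I (\<lambda>s. cmap c (\<eta> s)) s))"
    unfolding S_def
    using smooth_on_deriv_on(1)[OF smooth_chart_curve[OF c(1)] openin_chart_times[OF c(1)] at_within_nontrivial]
    by (intro smooth_on_Pair smooth_chart_curve[OF c(1)])
  then have z: "smooth_on S z"
    by (rule smooth_on_cong) (use c in \<open>auto simp: z_def tcoords_def velocity_def charts_at_def S_def\<close>)
  have "smooth_on {z. fst z \<in> cimage c \<and> tvec_of A c z \<in> W} (local_rep A f c)"
    using f c by (simp add: smooth_on_bundle_def)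
  moreover have "z ` S \<subseteq> {z. fst z \<in> cimage c \<and> tvec_of A c z \<in> W}"
    using vec W by (auto simp: S_def) (auto simp: z_def tcoords_def velocity_def cimage_def)
  ultimately have "smooth_on S (\<lambda>s. local_rep A f c (z s))" using smooth_on_compose z by blast
  then have "smooth_on S (\<lambda>t. f (velocity A I \<eta> t))"
    by (rule smooth_on_cong) (simp add: local_rep_def vec)
  then show "\<exists>V. openin (top_of_set I) V \<and> t \<in> V \<and> smooth_on V (\<lambda>t. f (velocity A I \<eta> t))"
    using openin_chart_times[OF c(1)] c \<open>t \<in> I\<close> by (intro exI[of _ S]) (auto simp: S_def)
qed

section \<open>Normal spaces, fields along the curve and the Leibniz rule\<close>

lemma tadd_in_orth_space:
  "v \<in> orth_space A L I \<eta> t \<Longrightarrow> w \<in> orth_space A L I \<eta> t \<Longrightarrow> tadd v w \<in> orth_space A L I \<eta> t"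
  unfolding orth_space_def using tadd_in_tangent_space[of v "\<eta> t" w]
  by (auto simp: tadd_def distrib_left sum.distrib)

lemma tscale_in_orth_space:
  assumes "v \<in> orth_space A L I \<eta> t"
  shows "tscale a v \<in> orth_space A L I \<eta> t"
proof -
  have "(\<Sum>\<alpha>\<in>UNIV. \<Sum>\<beta>\<in>UNIV. G \<alpha> \<beta> * V $ \<alpha> * (a *\<^sub>R w) $ \<beta>) = a * (\<Sum>\<alpha>\<in>UNIV. \<Sum>\<beta>\<in>UNIV. G \<alpha> \<beta> * V $ \<alpha> * w $ \<beta>)"
    for G :: "'d \<Rightarrow> 'd \<Rightarrow> real" and V w :: "real ^ 'd"
    by (simp add: sum_distrib_left mult.left_commute)
  then show ?thesis
    using assms tscale_in_tangent_space[of v "\<eta> t" a] unfolding orth_space_def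
    by (simp add: tscale_def)
qed

lemma smooth_field_along_tadd:
  assumes "smooth_field_along A I \<eta> Y" "smooth_field_along A I \<eta> Z"
  shows "smooth_field_along A I \<eta> (\<lambda>t. tadd (Y t) (Z t))"
  using assms unfolding smooth_field_along_def
  by (auto intro: tadd_in_tangent_space) (auto simp: tadd_def split_paired_all intro!: smooth_on_add)

lemma smooth_field_along_tscale:
  assumes "smooth_field_along A I \<eta> Y" "smooth_on I g"
  shows "smooth_field_along A I \<eta> (\<lambda>t. tscale (g t) (Y t))"
  using assms unfolding smooth_field_along_def
  by (auto intro: tscale_in_tangent_space)
    (auto simp: tscale_def intro!: smooth_on_scaleR intro: smooth_on_subset)

lemma field_component_deriv:
  assumes "smooth_field_along A I \<eta> Y" "t \<in> I" "c \<in> charts_at A (\<eta> t)"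
  shows "((\<lambda>s. tcomp (Y s) c) has_vector_derivative deriv_on I (\<lambda>s. tcomp (Y s) c) t) (at t within I)"
  using assms
  by (intro smooth_on_deriv_on(2)[of "{t \<in> I. \<eta> t \<in> cdom c}"] openin_chart_times at_within_nontrivial)
     (auto simp: smooth_field_along_def charts_at_def)

text \<open>The connection term is linear in the field. Smoothness enters for the other term,
  because \<open>vector_derivative\<close> is additive only where derivatives exist.\<close>

lemma cov_deriv_tadd:
  assumes Y: "smooth_field_along A I \<eta> Y" and Z: "smooth_field_along A I \<eta> Z" and t: "t \<in> I"
  shows "cov_deriv A L I \<eta> (\<lambda>s. tadd (Y s) (Z s)) t
    = tadd (cov_deriv A L I \<eta> Y t) (cov_deriv A L I \<eta> Z t)"
proof -
  have "deriv_on I (\<lambda>s. tcomp (Y s) c + tcomp (Z s) c) t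
      = deriv_on I (\<lambda>s. tcomp (Y s) c) t + deriv_on I (\<lambda>s. tcomp (Z s) c) t"
    if "c \<in> charts_at A (\<eta> t)" for c
    using that at_within_nontrivial[OF t]
    by (intro vector_derivative_within has_vector_derivative_add field_component_deriv Y Z t)
  then show ?thesis
    unfolding cov_deriv_def tadd_def
    by (auto simp: vec_eq_iff distrib_left sum.distrib)
qed

lemma cov_deriv_tscale:
  assumes Y: "smooth_field_along A I \<eta> Y" and t: "t \<in> I"
    and g: "(g has_vector_derivative g') (at t within I)"
  shows "cov_deriv A L I \<eta> (\<lambda>s. tscale (g s) (Y s)) t
    = tadd (tscale (g t) (cov_deriv A L I \<eta> Y t)) (tscale g' (Y t))"
proof -
  have "deriv_on I (\<lambda>s. g s *\<^sub>R tcomp (Y s) c) t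
      = g t *\<^sub>R deriv_on I (\<lambda>s. tcomp (Y s) c) t + g' *\<^sub>R tcomp (Y t) c"
    if "c \<in> charts_at A (\<eta> t)" for c
    using that at_within_nontrivial[OF t] g
    by (intro vector_derivative_within has_vector_derivative_scaleR field_component_deriv Y t)
       (simp_all add: has_real_derivative_iff_has_vector_derivative)
  \<comment> \<open>At charts away from the point \<open>cov_deriv\<close> is 0 by convention, so
    the extra summand with \<open>g'\<close> has to vanish there too.\<close>
  moreover have "tcomp (Y t) c = 0" if "c \<notin> charts_at A (\<eta> t)" for c
    using tangent_space_outside[OF _ that, of "Y t"] Y t by (simp add: smooth_field_along_def)
  ultimately show ?thesis
    unfolding cov_deriv_def tadd_def tscale_def
    by (auto simp: vec_eq_iff sum_distrib_left algebra_simps)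
qed

section \<open>Endomorphism fields and their derivatives\<close>

lemma smooth_endo_field_tadd:
  assumes "smooth_endo_field A L I \<eta> E" "smooth_endo_field A L I \<eta> F"
  shows "smooth_endo_field A L I \<eta> (\<lambda>t w. tadd (E t w) (F t w))"
  using assms unfolding smooth_endo_field_def
  by (auto intro: tadd_in_orth_space smooth_field_along_tadd)
    (auto simp: tadd_def tscale_def scaleR_right_distrib algebra_simps)

lemma smooth_endo_field_tscale:
  assumes "smooth_endo_field A L I \<eta> E" "smooth_on I g"
  shows "smooth_endo_field A L I \<eta> (\<lambda>t w. tscale (g t) (E t w))"
  using assms unfolding smooth_endo_field_def
  by (auto intro: tscale_in_orth_space smooth_field_along_tscale)
    (auto simp: tadd_def tscale_def scaleR_right_distrib algebra_simps)

lemma has_endo_deriv_tadd: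
  assumes E: "has_endo_deriv A L I \<eta> E E'" and F: "has_endo_deriv A L I \<eta> F F'"
  shows "has_endo_deriv A L I \<eta> (\<lambda>t w. tadd (E t w) (F t w)) (\<lambda>t w. tadd (E' t w) (F' t w))"
  unfolding has_endo_deriv_def
proof (intro conjI allI impI ballI)
  fix P t assume P: "smooth_normal_field A L I \<eta> P" and t: "t \<in> I"
  have "smooth_field_along A I \<eta> (\<lambda>s. E s (P s))" "smooth_field_along A I \<eta> (\<lambda>s. F s (P s))"
    using E F P by (auto simp: has_endo_deriv_def smooth_endo_field_def)
  note sum = cov_deriv_tadd[OF this t]
  have "E' t (P t) = tadd (cov_deriv A L I \<eta> (\<lambda>s. E s (P s)) t) (tscale (-1) (E t (cov_deriv A L I \<eta> P t)))"
    "F' t (P t) = tadd (cov_deriv A L I \<eta> (\<lambda>s. F s (P s)) t) (tscale (-1) (F t (cov_deriv A L I \<eta> P t)))"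
    using E F P t by (auto simp: has_endo_deriv_def)
  then show "tadd (E' t (P t)) (F' t (P t)) = tadd (cov_deriv A L I \<eta> (\<lambda>s. tadd (E s (P s)) (F s (P s))) t)
      (tscale (-1) (tadd (E t (cov_deriv A L I \<eta> P t)) (F t (cov_deriv A L I \<eta> P t))))"
    unfolding sum by (simp add: tadd_def tscale_def algebra_simps)
qed (use assms in \<open>auto simp: has_endo_deriv_def intro: smooth_endo_field_tadd\<close>)

text \<open>From (g E(P))' - g E(P') = g (E(P)' - E(P')) + g' E(P): the term E(P') is only carried
  along, so the Leibniz rule for fields passes to endomorphisms.\<close>

lemma has_endo_deriv_tscale:
  assumes E: "has_endo_deriv A L I \<eta> E E'" and g: "smooth_on I g" "smooth_on I g'"
    and deriv: "\<And>t. t \<in> I \<Longrightarrow> (g has_vector_derivative g' t) (at t within I)"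
  shows "has_endo_deriv A L I \<eta> (\<lambda>t w. tscale (g t) (E t w))
    (\<lambda>t w. tadd (tscale (g t) (E' t w)) (tscale (g' t) (E t w)))"
  unfolding has_endo_deriv_def
proof (intro conjI allI impI ballI)
  fix P t assume P: "smooth_normal_field A L I \<eta> P" and t: "t \<in> I"
  have "smooth_field_along A I \<eta> (\<lambda>s. E s (P s))"
    using E P by (auto simp: has_endo_deriv_def smooth_endo_field_def)
  note prod = cov_deriv_tscale[OF this t deriv[OF t]]
  have "E' t (P t) = tadd (cov_deriv A L I \<eta> (\<lambda>s. E s (P s)) t) (tscale (-1) (E t (cov_deriv A L I \<eta> P t)))"
    using E P t by (auto simp: has_endo_deriv_def)
  then show "tadd (tscale (g t) (E' t (P t))) (tscale (g' t) (E t (P t)))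
      = tadd (cov_deriv A L I \<eta> (\<lambda>s. tscale (g s) (E s (P s))) t)
          (tscale (-1) (tscale (g t) (E t (cov_deriv A L I \<eta> P t))))"
    unfolding prod by (simp add: tadd_def tscale_def algebra_simps)
qed (use assms in \<open>auto simp: has_endo_deriv_def intro: smooth_endo_field_tadd smooth_endo_field_tscale\<close>)

text \<open>Every weight in the equation is the exponential of a constant multiple of
  \<open>f\<close>; the three conclusions are the data that \<open>has_endo_deriv_tscale\<close>
  asks of its scalar factor.\<close>

lemma smooth_exp_scaled:
  fixes f :: "real \<Rightarrow> real"
  assumes "smooth_on I f"
  shows "smooth_on I (\<lambda>t. exp (k * f t))"
    and "smooth_on I (\<lambda>t. k * deriv_on I f t * exp (k * f t))"
    and "t \<in> I \<Longrightarrow> ((\<lambda>t. exp (k * f t)) has_vector_derivative k * deriv_on I f t * exp (k * f t)) (at t within I)"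
proof -
  have D: "smooth_on I (deriv_on I f)"
    "t \<in> I \<Longrightarrow> (f has_vector_derivative deriv_on I f t) (at t within I)" for t
    using smooth_on_deriv_on[OF assms, of I] at_within_nontrivial by auto
  show e: "smooth_on I (\<lambda>t. exp (k * f t))"
    by (intro smooth_on_exp smooth_on_mult smooth_on_const assms)
  show "smooth_on I (\<lambda>t. k * deriv_on I f t * exp (k * f t))"
    by (intro smooth_on_mult smooth_on_const D(1) e)
  show "((\<lambda>t. exp (k * f t)) has_vector_derivative k * deriv_on I f t * exp (k * f t)) (at t within I)"
    if "t \<in> I"
    using D(2)[OF that] unfolding has_real_derivative_iff_has_vector_derivative[symmetric]
    by (auto intro!: derivative_eq_intros)
qed

end

section \<open>Smoothness of the weight along a timelike geodesic\<close>

lemma finsler_zero: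
  assumes "lorentz_finsler T A L" "tzero p \<in> tangent_bundle T A"
  shows "L (tzero p) = 0"
proof -
  \<comment> \<open>Scaling by 2 fixes the zero vector, so its value under \<open>L\<close> equals
    four times itself.\<close>
  have "L (tscale 2 (tzero p)) = 2\<^sup>2 * L (tzero p)"
    using assms unfolding lorentz_finsler_def by (metis zero_less_numeral)
  then show ?thesis by (simp add: tscale_def tzero_def)
qed

text \<open>The velocity is future-directed timelike, hence in \<open>Omega\<close> and in its
  closure, and it is nonzero because \<open>L\<close> is negative on it but 0 at zero vectors. So it
  stays where \<psi> is assumed smooth.\<close>

lemma smooth_weight_along:
  assumes spacetime: "weighted_finsler_spacetime T A L X \<psi>"
    and I: "is_interval I" "interior I \<noteq> {}"
    and geo: "unit_speed_timelike_geodesic T A L X I \<eta>"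
  shows "smooth_on I (weight_along A I \<eta> \<psi>)"
proof -
  interpret curve_in_manifold T A I \<eta>
    using assms
    by unfold_locales (auto simp: weighted_finsler_spacetime_def finsler_spacetime_def
        unit_speed_timelike_geodesic_def causal_geodesic_def)
  have "velocity A I \<eta> t \<in> Omega_bar T A L X - zero_section T" if t: "t \<in> I" for t
  proof -
    let ?v = "velocity A I \<eta> t"
    have base: "tbase ?v = \<eta> t" by (simp add: velocity_def)
    have tan: "?v \<in> tangent_space A (\<eta> t)" using velocity_in_tangent_space[OF t] .
    then have tb: "?v \<in> tangent_bundle T A" using in_topspace[OF t] by (auto simp: tangent_bundle_def)
    have neg: "timelike L ?v" "future_directed A L X ?v"
      using geo t by (auto simp: unit_speed_timelike_geodesic_def causal_geodesic_def)
    then have "?v \<in> Omega A L X (tbase ?v)" using tan base by (simp add: Omega_def)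
    then have "?v \<in> Omega_bar T A L X"
      using tb closure_subset by (fastforce simp: Omega_bar_def)
    moreover have "L (tzero p) = 0" if "tzero p \<in> tangent_bundle T A" for p
      using finsler_zero that spacetime
      by (auto simp: weighted_finsler_spacetime_def finsler_spacetime_def)
    then have "?v \<notin> zero_section T" using tb neg(1) by (auto simp: zero_section_def timelike_def)
    ultimately show ?thesis by blast
  qed
  moreover have "smooth_on_bundle A (Omega_bar T A L X - zero_section T) \<psi>"
    using spacetime by (simp add: weighted_finsler_spacetime_def)
  ultimately show ?thesis
    unfolding weight_along_def using smooth_bundle_function_velocity by blast
qed

text \<open>Moves the factor exp(-f/n) out of the curvature term, so that the Jacobi equation for
  \<open>J\<close> itself applies.\<close>

lemma curv_tscale: "curv A L v (tscale a w) = tscale a (curv A L v w)"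
  by (auto simp: curv_def tscale_def vec_eq_iff sum_distrib_left mult.left_commute)

section \<open>The weighted Jacobi equation\<close>

theorem lemma5p4:
  fixes T :: "'m topology" and A :: "('m, 'd::finite) chart set"
    and L :: "('m, 'd) tvec \<Rightarrow> real" and X :: "'m \<Rightarrow> ('m, 'd) tvec"
    and \<psi> :: "('m, 'd) tvec \<Rightarrow> real"
    and I :: "real set" and \<eta> :: "real \<Rightarrow> 'm"
    and J :: "real \<Rightarrow> ('m, 'd) tvec \<Rightarrow> ('m, 'd) tvec"
    and n :: nat and \<epsilon> :: real
  assumes "n \<ge> 1" and "CARD('d) = n + 1"
    and "weighted_finsler_spacetime T A L X \<psi>"
    and "is_interval I" and "interior I \<noteq> {}"
    and "unit_speed_timelike_geodesic T A L X I \<eta>"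
    and "jacobi_tensor A L I \<eta> J"
  shows "let \<psi>\<^sub>\<eta> = weight_along A I \<eta> \<psi>; J\<^sub>\<psi> = weighted_endo n \<psi>\<^sub>\<eta> J in
    \<exists>J1 J2.
      has_endo_tau_deriv A L I \<eta> n \<epsilon> \<psi>\<^sub>\<eta> J\<^sub>\<psi> J1 \<and>
      has_endo_tau_deriv A L I \<eta> n \<epsilon> \<psi>\<^sub>\<eta> J1 J2 \<and>
      (\<forall>t\<in>I. \<forall>w\<in>orth_space A L I \<eta> t.
         tadd (tadd (J2 t w) (tscale (2 * \<epsilon> / real n * tau_deriv n \<epsilon> \<psi>\<^sub>\<eta> I \<psi>\<^sub>\<eta> t) (J1 t w)))
              (weighted_curv A L I \<eta> n \<psi>\<^sub>\<eta> 0 \<epsilon> t (J\<^sub>\<psi> t w)) = tzero (\<eta> t))"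
proof -
  interpret curve_in_manifold T A I \<eta>
    using assms
    by unfold_locales (auto simp: weighted_finsler_spacetime_def finsler_spacetime_def
        unit_speed_timelike_geodesic_def causal_geodesic_def)
  define f where "f = weight_along A I \<eta> \<psi>"
  define k where "k = 1 / real n"
  define f' where "f' = deriv_on I f"
  define f'' where "f'' = deriv_on I f'"
  define u where "u t = exp (- k * f t)" for t
  define r where "r t = exp (2 * (1 - \<epsilon>) * k * f t)" for t
  \<comment> \<open>This is \<open>r * u\<close>, the rate dt/d\<tau> times the weight, and hence
    the coefficient of \<open>J'\<close> in the first \<tau>-derivative.\<close>
  define a where "a t = exp ((1 - 2 * \<epsilon>) * k * f t)" for t
  define a' where "a' t = (1 - 2 * \<epsilon>) * k * f' t * a t" for t
  \<comment> \<open>The coefficient of \<open>J\<close> in the first \<tau>-derivative: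
    \<open>r\<close> times the derivative of \<open>u\<close>.\<close>
  define b where "b t = - k * (f' t * a t)" for t
  define b' where "b' t = - k * (f' t * a' t + f'' t * a t)" for t
  obtain J' J'' where J: "has_endo_deriv A L I \<eta> J J'" "has_endo_deriv A L I \<eta> J' J''"
    and jacobi: "\<And>t w. t \<in> I \<Longrightarrow> w \<in> orth_space A L I \<eta> t \<Longrightarrow>
        tadd (J'' t w) (curv A L (velocity A I \<eta> t) (J t w)) = tzero (\<eta> t)"
    using assms(7) unfolding jacobi_tensor_def by blast
  have f: "smooth_on I f" unfolding f_def using smooth_weight_along assms by blast
  have f': "smooth_on I f'"
    using smooth_on_deriv_on[OF f, of I] at_within_nontrivial by (auto simp: f'_def)
  have f'': "smooth_on I f''"
    and f'_deriv: "t \<in> I \<Longrightarrow> (f' has_vector_derivative f'' t) (at t within I)" for t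
    using smooth_on_deriv_on[OF f', of I] at_within_nontrivial by (auto simp: f''_def)
  note exps = smooth_exp_scaled[OF f]
  have a: "smooth_on I a" "smooth_on I a'"
    and a_deriv: "t \<in> I \<Longrightarrow> (a has_vector_derivative a' t) (at t within I)" for t
    unfolding a_def a'_def f'_def by (intro exps; assumption)+
  have b: "smooth_on I b" "smooth_on I b'"
    unfolding b_def b'_def by (intro smooth_on_mult smooth_on_add smooth_on_const a f' f'')+
  have b_deriv: "(b has_vector_derivative b' t) (at t within I)" if "t \<in> I" for t
    unfolding b_def b'_def
    using a_deriv[OF that] f'_deriv[OF that]
    unfolding has_real_derivative_iff_has_vector_derivative[symmetric]
    by (auto intro!: derivative_eq_intros)
  have "has_endo_deriv A L I \<eta> (\<lambda>t w. tscale (u t) (J t w))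
      (\<lambda>t w. tadd (tscale (u t) (J' t w)) (tscale (- k * f' t * u t) (J t w)))"
    unfolding u_def f'_def by (intro has_endo_deriv_tscale J exps)
  moreover have "weighted_endo n f J = (\<lambda>t w. tscale (u t) (J t w))"
    by (auto simp: weighted_endo_def u_def k_def fun_eq_iff)
  ultimately have D0: "has_endo_deriv A L I \<eta> (weighted_endo n f J)
      (\<lambda>t w. tadd (tscale (u t) (J' t w)) (tscale (- k * f' t * u t) (J t w)))"
    by simp
  define J1 where "J1 t w = tadd (tscale (a t) (J' t w)) (tscale (b t) (J t w))" for t w
  define J1' where "J1' t w = tadd (tadd (tscale (a t) (J'' t w)) (tscale (a' t) (J' t w)))
      (tadd (tscale (b t) (J' t w)) (tscale (b' t) (J t w)))" for t w
  have D1: "has_endo_deriv A L I \<eta> J1 J1'"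
    unfolding J1_def J1'_def by (intro has_endo_deriv_tadd has_endo_deriv_tscale J a a_deriv b b_deriv)
  have rate: "tau_rate n \<epsilon> f t = r t" for t by (simp add: tau_rate_def r_def k_def)
  have ru: "r t * u t = a t" for t
    by (simp add: r_def u_def a_def exp_add[symmetric] algebra_simps)
  have "has_endo_tau_deriv A L I \<eta> n \<epsilon> f (weighted_endo n f J) J1"
    unfolding has_endo_tau_deriv_def
    by (intro exI conjI ballI, rule D0)
      (auto simp: J1_def rate b_def ru[symmetric] tadd_def tscale_def fun_eq_iff algebra_simps)
  moreover have "has_endo_tau_deriv A L I \<eta> n \<epsilon> f J1 (\<lambda>t w. tscale (r t) (J1' t w))"
    unfolding has_endo_tau_deriv_def using D1 by (auto simp: rate)
  moreover have "tadd (tadd (tscale (r t) (J1' t w)) (tscale (2 * \<epsilon> / real n * tau_deriv n \<epsilon> f I f t) (J1 t w)))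
      (weighted_curv A L I \<eta> n f 0 \<epsilon> t (weighted_endo n f J t w)) = tzero (\<eta> t)"
    if t: "t \<in> I" and w: "w \<in> orth_space A L I \<eta> t" for t w
  proof (rule prod_eqI)
    let ?R = "curv A L (velocity A I \<eta> t) (J t w)"
    \<comment> \<open>\<open>tadd\<close> takes the base point of its left argument, so the base
      point of the whole sum is that of \<open>J'' t w\<close>.\<close>
    have "J'' t w \<in> orth_space A L I \<eta> t"
      using J(2) t w by (simp add: has_endo_deriv_def smooth_endo_field_def)
    then have "tbase (J'' t w) = \<eta> t" by (simp add: orth_space_def tangent_space_def)
    then show "tbase (tadd (tadd (tscale (r t) (J1' t w)) (tscale (2 * \<epsilon> / real n * tau_deriv n \<epsilon> f I f t) (J1 t w)))
        (weighted_curv A L I \<eta> n f 0 \<epsilon> t (weighted_endo n f J t w))) = tbase (tzero (\<eta> t) :: ('m, 'd) tvec)"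
      by (simp add: tadd_def tscale_def J1'_def tzero_def)
    \<comment> \<open>The Jacobi equation is used to eliminate the curvature in favour of
      \<open>J''\<close>; its two occurrences then have coefficients r a and - r^2 u, which are
      opposite.\<close>
    have R: "tcomp ?R c = - tcomp (J'' t w) c" for c
    proof -
      have "tcomp (tadd (J'' t w) ?R) c = 0" using jacobi[OF t w] by (simp add: tzero_def)
      then show ?thesis by (simp add: tadd_def eq_neg_iff_add_eq_0 add.commute)
    qed
    have sq: "exp (4 * (1 - \<epsilon>) / real n * f t) = r t * r t"
      by (simp add: r_def k_def exp_add[symmetric])
    \<comment> \<open>Here N = 0 makes the denominator -n, so the quadratic term changes sign and
      becomes the square of \<open>k * f' t\<close>.\<close>
    have kn: "1 / real n * (f'' t - (f' t)\<^sup>2 / (0 - real n)) = k * f'' t + (k * f' t)\<^sup>2"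
      using assms(1) by (simp add: k_def power2_eq_square field_simps)
    have d: "deriv_on I (deriv_on I f) t = f'' t" "deriv_on I f t = f' t"
      by (simp_all add: f'_def f''_def)
    have wc: "weighted_curv A L I \<eta> n f 0 \<epsilon> t (weighted_endo n f J t w)
        = tscale (r t * r t) (tadd (tscale (u t) ?R) (tscale (k * f'' t + (k * f' t)\<^sup>2) (tscale (u t) (J t w))))"
      unfolding weighted_curv_def weighted_endo_def d sq kn curv_tscale
      by (simp add: u_def k_def)
    have td: "2 * \<epsilon> / real n * tau_deriv n \<epsilon> f I f t = 2 * \<epsilon> * k * r t * f' t"
      by (simp add: tau_deriv_def rate f'_def k_def)
    show "tcomp (tadd (tadd (tscale (r t) (J1' t w)) (tscale (2 * \<epsilon> / real n * tau_deriv n \<epsilon> f I f t) (J1 t w)))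
        (weighted_curv A L I \<eta> n f 0 \<epsilon> t (weighted_endo n f J t w))) = tcomp (tzero (\<eta> t) :: ('m, 'd) tvec)"
      \<comment> \<open>Up to the factor r a, the coefficient of \<open>J'\<close> is k f' times (1
        - 2\<epsilon>) - 1 + 2\<epsilon>. That of \<open>J\<close> is k f'' times -1 + 1 plus (k
        f')^2 times -(1 - 2\<epsilon>) - 2\<epsilon> + 1. All three numbers vanish.\<close>
      unfolding wc td
      by (simp add: fun_eq_iff vec_eq_iff tzero_def tadd_def tscale_def J1_def J1'_def R b_def b'_def a'_def
          ru[symmetric] algebra_simps power2_eq_square)
  qed
  ultimately show ?thesis unfolding Let_def f_def[symmetric] by blast
qed

end
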